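(* Let $q=p^s$ be a prime power, $m\ge1$ an integer, $r=q^m$, and let $e$ be a positive divisor of $q-1$. If $\gcd(e,m)=2$, then $C_q(m,e)$ is a three-weight code (with respect to the Lee weight) of length $\frac{r^2-r}{e}$ and size $r^2$, and its Lee weight enumerator is $$A_{C_q(m,e)}(z)=1+\frac{r-1}{2}\,z^{2\frac{q-1}{eq}(r^2-r^{3/2})}+(r^2-r)\,z^{2\frac{q-1}{eq}(r^2-r)}+\frac{r-1}{2}\,z^{2\frac{q-1}{eq}(r^2+r^{3/2})}.$$
   Context: Let $p$ be a prime, $q=p^s$, $r=q^m$ with $s,m\ge1$. Let $R=\mathbb{F}_q+u\mathbb{F}_q$ and $\mathcal{R}=\mathbb{F}_r+u\mathbb{F}_r$, where $u^2=0$. The trace $Tr:\mathcal{R}\to R$ is $Tr(a+ub)=Tr_{r/q}(a)+u\,Tr_{r/q}(b)$ for $a,b\in\mathbb{F}_r$, where $Tr_{r/q}$ is the trace function from $\mathbb{F}_r$ to $\mathbb{F}_q$. Let $\alpha$ be a generator of $\mathbb{F}_r^*$. For a positive divisor $e$ of $q-1$, let $C_0^{(e,r)}=\langle\alpha^e\rangle$ be the subgroup of $\mathbb{F}_r^*$ generated by $\alpha^e$, and let $L=C_0^{(e,r)}+u\mathbb{F}_r=\{t+ut' : t\in C_0^{(e,r)},\ t'\in\mathbb{F}_r\}\subseteq\mathcal{R}^*$, so $n:=|L|=\frac{r^2-r}{e}$. For $a\in\mathcal{R}$ put $ev(a)=(Tr(ax))_{x\in L}\in R^n$. The trace code is $C_q(m,e)=\{ev(a)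 : a\in\mathcal{R}\}\subseteq R^n$. The Gray map is $\phi:R^n\to\mathbb{F}_q^{2n}$, $\phi(\mathbf{a}+u\mathbf{b})=(\mathbf{b},\mathbf{a}+\mathbf{b})$ for $\mathbf a,\mathbf b\in\mathbb{F}_q^n$. The Lee weight of $\mathbf{x}\in R^n$ is the Hamming weight of its Gray image: $w_L(\mathbf{a}+u\mathbf{b})=w_H(\mathbf{b})+w_H(\mathbf{a}+\mathbf{b})$. The Lee weight enumerator of a code $C\subseteq R^n$ is $A_C(z)=\sum_{c\in C}z^{w_L(c)}$. A code is a $t$-weight code if exactly $t$ distinct values occur as weights of its nonzero codewords. *)

theory Defs
  imports Complex_Main
    "HOL-Library.Cardinality"
    "HOL-Library.FuncSet"
    "HOL-Computational_Algebra.Computational_Algebra"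
begin

text \<open>\<open>Dual a b\<close> stands for \<open>a + u b\<close> with \<open>u * u = 0\<close>; see \<open>u_square\<close> and \<open>Dual_eq\<close> below.\<close>

datatype 'a dual = Dual (base_part: 'a) (u_part: 'a)

instantiation dual :: (comm_ring_1) comm_ring_1
begin

definition zero_dual :: "'a dual" where "0 = Dual 0 0"
definition one_dual :: "'a dual" where "1 = Dual 1 0"
definition plus_dual :: "'a dual \<Rightarrow> 'a dual \<Rightarrow> 'a dual" where
  "x + y = Dual (base_part x + base_part y) (u_part x + u_part y)"
definition uminus_dual :: "'a dual \<Rightarrow> 'a dual" where
  "- x = Dual (- base_part x) (- u_part x)"
definition minus_dual :: "'a dual \<Rightarrow> 'a dual \<Rightarrow> 'a dual" where
  "x - y = Dual (base_part x - base_part y) (u_part x - u_part y)"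
definition times_dual :: "'a dual \<Rightarrow> 'a dual \<Rightarrow> 'a dual" where
  "x * y = Dual (base_part x * base_part y)
                (base_part x * u_part y + u_part x * base_part y)"

instance
  by standard
    (auto simp: zero_dual_def one_dual_def plus_dual_def uminus_dual_def minus_dual_def
      times_dual_def algebra_simps intro: dual.expand)

end

lemma u_square: "Dual 0 1 * Dual 0 1 = (0 :: 'a::comm_ring_1 dual)"
  by (simp add: times_dual_def zero_dual_def)

lemma Dual_eq: "Dual a b = Dual a 0 + Dual 0 1 * Dual (b :: 'a::comm_ring_1) 0"
  by (simp add: times_dual_def plus_dual_def)

text \<open>Throughout, the field \<open>\<bbbF>\<^sub>r\<close> is a finite field type \<open>'a\<close>, the ring \<open>\<bbbF>\<^sub>r + u\<bbbF>\<^sub>r\<close> is \<open>'a dual\<close>,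
  and the field \<open>\<bbbF>\<^sub>q\<close> is a subfield of \<open>'a\<close>.\<close>

definition is_subfield :: "'a::field set \<Rightarrow> bool" where
  "is_subfield F \<longleftrightarrow> 0 \<in> F \<and> 1 \<in> F \<and>
     (\<forall>x\<in>F. \<forall>y\<in>F. x - y \<in> F \<and> x * y \<in> F) \<and> (\<forall>x\<in>F. inverse x \<in> F)"

definition dual_over :: "'a set \<Rightarrow> 'a dual set" where
  "dual_over F = {Dual a b |a b. a \<in> F \<and> b \<in> F}"

text \<open>For \<open>x \<noteq> 0\<close>, the subgroup of the multiplicative group of the field generated by \<open>x\<close>.\<close>

definition cyclic_subgroup :: "'a::field \<Rightarrow> 'a set" where
  "cyclic_subgroup x = range (\<lambda>k::int. x powi k)"

definition is_generator :: "'a::field \<Rightarrow> bool" where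
  "is_generator \<alpha> \<longleftrightarrow> \<alpha> \<noteq> 0 \<and> cyclic_subgroup \<alpha> = UNIV - {0}"

text \<open>The trace of the extension of degree \<open>m\<close> over the field with \<open>q\<close> elements,
  and its coordinatewise extension to dual numbers.\<close>

definition field_trace :: "nat \<Rightarrow> nat \<Rightarrow> 'a::field \<Rightarrow> 'a" where
  "field_trace q m x = (\<Sum>i<m. x ^ (q ^ i))"

definition dual_trace :: "nat \<Rightarrow> nat \<Rightarrow> 'a::field dual \<Rightarrow> 'a dual" where
  "dual_trace q m x = Dual (field_trace q m (base_part x)) (field_trace q m (u_part x))"

definition defining_set :: "'a::field \<Rightarrow> nat \<Rightarrow> 'a dual set" where
  "defining_set \<alpha> e = {Dual t t' |t t'. t \<in> cyclic_subgroup (\<alpha> ^ e)}"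

text \<open>A word of length \<open>n\<close> over an alphabet \<open>A\<close> is an element of \<open>I \<rightarrow>\<^sub>E A\<close> for an index set \<open>I\<close>
  with \<open>n\<close> elements; here \<open>I\<close> is \<open>defining_set \<alpha> e\<close>.\<close>

definition ev :: "nat \<Rightarrow> nat \<Rightarrow> 'a dual set \<Rightarrow> 'a::field dual \<Rightarrow> ('a dual \<Rightarrow> 'a dual)" where
  "ev q m L a = (\<lambda>x\<in>L. dual_trace q m (a * x))"

definition trace_code :: "nat \<Rightarrow> nat \<Rightarrow> nat \<Rightarrow> 'a::field \<Rightarrow> ('a dual \<Rightarrow> 'a dual) set" where
  "trace_code q m e \<alpha> = range (ev q m (defining_set \<alpha> e))"

definition hamming_weight :: "'i set \<Rightarrow> ('i \<Rightarrow> 'b::zero) \<Rightarrow> nat" where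
  "hamming_weight I v = card {i \<in> I. v i \<noteq> 0}"

text \<open>The Gray image \<open>(b, a + b)\<close> of \<open>a + u b\<close> has two blocks, both indexed by \<open>I\<close>, so it is
  a vector indexed by the disjoint sum \<open>I <+> I\<close>.\<close>

definition gray :: "'i set \<Rightarrow> ('i \<Rightarrow> 'a::comm_ring_1 dual) \<Rightarrow> ('i + 'i \<Rightarrow> 'a)" where
  "gray I c = restrict
     (case_sum (\<lambda>i. u_part (c i)) (\<lambda>i. base_part (c i) + u_part (c i))) (I <+> I)"

definition lee_weight :: "'i set \<Rightarrow> ('i \<Rightarrow> 'a::comm_ring_1 dual) \<Rightarrow> nat" where
  "lee_weight I c = hamming_weight (I <+> I) (gray I c)"

definition lee_t_weight_code :: "'i set \<Rightarrow> nat \<Rightarrow> ('i \<Rightarrow> 'a::comm_ring_1 dual) set \<Rightarrow> bool" where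
  "lee_t_weight_code I t C \<longleftrightarrow>
     finite (lee_weight I ` (C - {\<lambda>i\<in>I. 0})) \<and> card (lee_weight I ` (C - {\<lambda>i\<in>I. 0})) = t"

definition lee_weight_enumerator :: "'i set \<Rightarrow> ('i \<Rightarrow> 'a::comm_ring_1 dual) set \<Rightarrow> real poly" where
  "lee_weight_enumerator I C = (\<Sum>c\<in>C. monom 1 (lee_weight I c))"

end

theory Submission imports Defs begin

text \<open>A codeword \<open>ev (a + u b)\<close> with \<open>a \<noteq> 0\<close> is equidistributed on every fibre over
  \<open>\<langle>\<alpha>\<^sup>e\<rangle>\<close>, so its Lee weight is immediate. For \<open>a = 0\<close> the weight counts the \<open>t \<in> \<langle>\<alpha>\<^sup>e\<rangle>\<close> with
  \<open>Tr(bt) \<noteq> 0\<close>. Since \<open>gcd e m = 2\<close>, the products \<open>ct\<close> with \<open>c \<in> \<bbbF>\<^sub>q\<^sup>*\<close> run uniformly over the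
  nonzero squares of \<open>\<bbbF>\<^sub>r\<close>, so the count is governed by the number \<open>N b\<close> of zeros of
  \<open>y \<mapsto> Tr(b y\<^sup>2)\<close>. This number depends only on whether \<open>b\<close> is a square, and the two values are
  determined, up to order, by the first two moments of \<open>N\<close>; no Gauss sums are needed.\<close>

section \<open>Finite fields and the trace\<close>

text \<open>The hypothesis \<open>gcd e m = 2\<close> acts through indices. In the cyclic group of
  nonzero elements, \<open>H\<close> has index \<open>e\<close> and \<open>F - {0}\<close> has index
  \<open>norm_exponent\<close>, which is congruent to \<open>m\<close> modulo \<open>e\<close>
  because \<open>q\<close> is 1 modulo \<open>e\<close>. Hence the two subgroups together generate
  the subgroup of index 2. Passing from \<open>H\<close> to this larger group loses nothing, since
  scaling \<open>x\<close> by a nonzero element of \<open>F\<close> does not affect whether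
  \<open>T (b * x)\<close> vanishes. The second moment is linear algebra over \<open>F\<close>: for
  nonzero \<open>y\<close> and \<open>z\<close> the conditions \<open>T (b * y ^ 2) = 0\<close> and
  \<open>T (b * z ^ 2) = 0\<close> on \<open>b\<close> are equivalent or independent, according to
  whether \<open>z ^ 2\<close> is an \<open>F\<close>-multiple of \<open>y ^ 2\<close>. The
  deviation of \<open>N\<close> from its mean \<open>r / q\<close> comes out as
  \<open>sqrt r * (q - 1) / q\<close>, and the free coordinate \<open>t'\<close> contributes the
  factor \<open>r\<close> that turns \<open>sqrt r\<close> into the exponent 3/2. Which class of
  \<open>b\<close> gets the larger value stays undecided; squares and nonsquares are equally
  numerous, so the enumerator is the same either way.\<close>

lemma power_card_eq_1:
  fixes x :: "'a::field"
  assumes "finite G" "0 \<notin> G" "x \<in> G" and mult: "\<And>y z. y \<in> G \<Longrightarrow> z \<in> G \<Longrightarrow> y * z \<in> G"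
  shows "x ^ card G = 1"
proof -
  have x: "x \<noteq> 0" using assms by auto
  have "inj_on ((*) x) G" using x by (auto simp: inj_on_def)
  moreover have "(*) x ` G \<subseteq> G" using assms by auto
  ultimately have im: "(*) x ` G = G" using \<open>finite G\<close> by (simp add: endo_inj_surj)
  \<comment> \<open>Multiplication by \<open>x\<close> permutes \<open>G\<close>, so it leaves the
    nonzero product over \<open>G\<close> unchanged while multiplying it by
    \<open>x ^ card G\<close>.\<close>
  have "\<Prod>G = (\<Prod>y\<in>G. x * y)"
    by (subst (1) im[symmetric]) (use \<open>inj_on ((*) x) G\<close> in \<open>simp add: prod.reindex\<close>)
  also have "\<dots> = x ^ card G * \<Prod>G" by (simp add: prod.distrib)
  finally show ?thesis using assms by simp
qed

text \<open>Translation by 1 permutes the ring, so the sum of all elements is not changed by adding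
  \<open>CARD\<close> ones. This ties the characteristic to the cardinality.\<close>

lemma of_nat_CARD_eq_0: "of_nat CARD('a::{ring_1,finite}) = (0::'a)"
proof -
  have "(\<Sum>x::'a\<in>UNIV. x) = (\<Sum>x\<in>UNIV. x + 1)"
    by (rule sum.reindex_bij_witness[of _ "\<lambda>x. x + 1" "\<lambda>x. x - 1"]) auto
  thus ?thesis by (simp add: sum.distrib)
qed

lemma card_roots_le_degree:
  fixes f :: "'a::field \<Rightarrow> 'a"
  assumes "\<And>x. f x = poly P x" "P \<noteq> 0"
  shows "card {x. f x = 0} \<le> degree P"
  using card_poly_roots_bound[OF assms(2)] assms(1) by simp

lemma card_Collect_of_bool: "real (card {x::'b::finite. P x}) = (\<Sum>x\<in>UNIV. of_bool (P x))"
  by (simp add: of_bool_def sum.If_cases)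

lemma is_subfieldD:
  assumes "is_subfield F"
  shows is_subfield_zero: "0 \<in> F" and is_subfield_one: "1 \<in> F"
    and is_subfield_diff: "x \<in> F \<Longrightarrow> y \<in> F \<Longrightarrow> x - y \<in> F"
    and is_subfield_mult: "x \<in> F \<Longrightarrow> y \<in> F \<Longrightarrow> x * y \<in> F"
    and is_subfield_inverse: "x \<in> F \<Longrightarrow> inverse x \<in> F"
  using assms by (auto simp: is_subfield_def)

lemma is_subfield_uminus: "is_subfield F \<Longrightarrow> x \<in> F \<Longrightarrow> - x \<in> F"
  using is_subfield_diff[of F 0 x] is_subfield_zero[of F] by simp

lemma is_subfield_divide: "is_subfield F \<Longrightarrow> x \<in> F \<Longrightarrow> y \<in> F \<Longrightarrow> x / y \<in> F"
  by (simp add: divide_inverse is_subfield_mult is_subfield_inverse)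

lemma is_subfield_power: "is_subfield F \<Longrightarrow> x \<in> F \<Longrightarrow> x ^ n \<in> F"
  by (induction n) (auto simp: is_subfield_one is_subfield_mult)

lemma is_subfield_power_int: "is_subfield F \<Longrightarrow> x \<in> F \<Longrightarrow> x powi n \<in> F"
  by (auto simp: power_int_def is_subfield_power is_subfield_inverse)

locale finite_field_extension =
  fixes p s q m :: nat and F :: "'a::{field,finite} set"
  assumes prime_p: "prime p" and s_pos: "s \<ge> 1" and q_def: "q = p ^ s"
    and m_pos: "m \<ge> 1" and CARD_eq: "CARD('a) = q ^ m"
    and subfield: "is_subfield F" and card_F: "card F = q"
begin

abbreviation "T \<equiv> field_trace q m :: 'a \<Rightarrow> 'a"

lemma q_gt_1: "q > 1"
  using prime_p s_pos prime_gt_1_nat[of p] one_less_power[of p s] unfolding q_def by simp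

lemma real_q_m: "real (q ^ m) = real q * real (q ^ (m - 1))"
  using m_pos by (cases m) auto

lemma CHAR_eq: "CHAR('a) = p"
proof -
  have "CHAR('a) dvd CARD('a)"
    by (metis of_nat_CARD_eq_0 of_nat_eq_0_iff_char_dvd)
  hence "CHAR('a) dvd p ^ (s * m)" by (simp add: CARD_eq q_def power_mult)
  moreover have "prime CHAR('a)" by (rule prime_CHAR_semidom[OF finite_imp_CHAR_pos]) simp
  ultimately show ?thesis
    using prime_dvd_power prime_p primes_dvd_imp_eq by blast
qed

lemma power_q_power_add: "(x + y :: 'a) ^ (q ^ i) = x ^ (q ^ i) + y ^ (q ^ i)"
  by (rule freshmans_dream'[where n = "s * i"]) (auto simp: CHAR_eq prime_p q_def power_mult)

lemma power_q_sum: "(\<Sum>i\<in>I. f i :: 'a) ^ q = (\<Sum>i\<in>I. f i ^ q)"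
  by (rule freshmans_dream_sum'[where n = s]) (auto simp: CHAR_eq prime_p q_def)

lemma power_CARD: "(x::'a) ^ (q ^ m) = x"
proof (cases "x = 0")
  case False
  have "x ^ card (UNIV - {0 :: 'a}) = 1" by (rule power_card_eq_1) (use False in auto)
  hence "x ^ (q ^ m - 1) = 1" by (simp add: CARD_eq)
  moreover have "x ^ (q ^ m) = x * x ^ (q ^ m - 1)"
    by (rule power_eq_if[THEN trans]) (use q_gt_1 in auto)
  ultimately show ?thesis by simp
qed (use q_gt_1 in auto)

lemma F_power_q:
  assumes "c \<in> F" shows "c ^ q = c"
proof (cases "c = 0")
  case False
  have "c ^ card (F - {0}) = 1"
    by (rule power_card_eq_1) (use False assms subfield in \<open>auto simp: is_subfield_mult\<close>)
  hence "c ^ (q - 1) = 1" using is_subfield_zero[OF subfield] by (simp add: card_F)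
  moreover have "c ^ q = c * c ^ (q - 1)"
    by (rule power_eq_if[THEN trans]) (use q_gt_1 in auto)
  ultimately show ?thesis by simp
qed (use q_gt_1 in auto)

lemma F_power_q_power: "c \<in> F \<Longrightarrow> c ^ (q ^ i) = c"
  by (induction i) (auto simp: power_mult F_power_q)

text \<open>All \<open>q\<close> elements of \<open>F\<close> are roots of \<open>X^q - X\<close>,
  which has at most \<open>q\<close> roots. Membership in \<open>F\<close> thus becomes invariance
  under the Frobenius map, the test applied to trace values and to
  \<open>\<alpha> ^ norm_exponent\<close>.\<close>

lemma F_eq: "F = {x. x ^ q = x}"
proof (rule card_subset_eq)
  let ?P = "monom 1 q - monom 1 1 :: 'a poly"
  have "coeff ?P q = 1" using q_gt_1 by simp
  hence nz: "?P \<noteq> 0" by (metis coeff_0 zero_neq_one)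
  have "card {x::'a. x ^ q - x = 0} \<le> degree ?P"
    by (rule card_roots_le_degree) (use nz in \<open>auto simp: poly_monom\<close>)
  also have "\<dots> \<le> q" using q_gt_1 by (intro degree_diff_le) (auto intro: order_trans[OF degree_monom_le])
  finally have "card {x::'a. x ^ q = x} \<le> card F" by (simp only: card_F right_minus_eq)
  moreover have "card F \<le> card {x::'a. x ^ q = x}" using F_power_q by (intro card_mono) auto
  ultimately show "card F = card {x::'a. x ^ q = x}" by (intro le_antisym)
qed (use F_power_q in auto)

section \<open>Linearity and fibres of the trace\<close>

lemma trace_add: "T (x + y) = T x + T y"
  by (simp add: field_trace_def power_q_power_add sum.distrib)

lemma trace_mult: "c \<in> F \<Longrightarrow> T (c * x) = c * T x"
  by (simp add: field_trace_def power_mult_distrib F_power_q_power sum_distrib_left)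

lemma trace_0 [simp]: "T 0 = 0"
  using q_gt_1 by (simp add: field_trace_def power_0_left)

lemma trace_diff: "T (x - y) = T x - T y"
  using trace_add[of "x - y" y] by simp

text \<open>The Frobenius map shifts the summands cyclically: the last one becomes
  \<open>x ^ (q ^ m) = x\<close>, which is the first.\<close>

lemma trace_in_F: "T x \<in> F"
proof -
  obtain k where k: "m = Suc k" using m_pos by (cases m) auto
  have pk: "x ^ (q ^ Suc k) = x" using power_CARD[of x] by (simp only: k)
  have "T x ^ q = (\<Sum>i<m. x ^ (q ^ Suc i))"
    by (simp add: field_trace_def power_q_sum power_mult[symmetric] mult.commute)
  also have "\<dots> = (\<Sum>i<k. x ^ (q ^ Suc i)) + x ^ (q ^ m)" by (simp add: k)
  also have "\<dots> = T x"
    by (simp add: field_trace_def pk k sum.lessThan_Suc_shift add.commute del: sum.lessThan_Suc power_Suc)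
  finally show ?thesis by (subst F_eq) simp
qed

text \<open>The trace is a polynomial of degree \<open>q\<^sup>m\<^sup>-\<^sup>1\<close>, which bounds each of the \<open>q\<close> fibres; the
  bounds are attained since the fibres add up to \<open>q\<^sup>m\<close>.\<close>

lemma card_trace_fibre:
  assumes "c \<in> F"
  shows "card {x. T x = c} = q ^ (m - 1)"
proof -
  have le: "card {x. T x = d} \<le> q ^ (m - 1)" for d
  proof -
    let ?P = "(\<Sum>i<m. monom 1 (q ^ i)) - [:d:] :: 'a poly"
    have inj: "q ^ i = q ^ j \<longleftrightarrow> i = j" for i j using q_gt_1 by simp
    \<comment> \<open>The exponents \<open>q ^ i\<close> are distinct, and the constant
      \<open>d\<close> sits at exponent 0, below \<open>q ^ (m - 1)\<close>; so the coefficient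
      there is 1 and the polynomial is nonzero.\<close>
    have "coeff ?P (q ^ (m - 1)) = (\<Sum>i<m. if i = m - 1 then 1 else 0)"
      using q_gt_1 by (simp add: coeff_sum inj coeff_pCons split: nat.split) 
    hence "coeff ?P (q ^ (m - 1)) = 1" using m_pos by simp
    hence nz: "?P \<noteq> 0" by (metis coeff_0 zero_neq_one)
    have "card {x. T x - d = 0} \<le> degree ?P"
      by (rule card_roots_le_degree) (use nz in \<open>auto simp: poly_monom poly_sum field_trace_def\<close>)
    also have "\<dots> \<le> q ^ (m - 1)"
      using q_gt_1 by (intro degree_diff_le degree_sum_le)
        (auto intro!: order_trans[OF degree_monom_le] power_increasing)
    finally show ?thesis by simp
  qed
  have "q ^ m = card (\<Union>d\<in>F. {x. T x = d})"
    using trace_in_F by (subst CARD_eq[symmetric], intro arg_cong[where f = card]) auto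
  also have "\<dots> = (\<Sum>d\<in>F. card {x. T x = d})" by (rule card_UN_disjoint) auto
  finally have sum: "(\<Sum>d\<in>F. card {x. T x = d}) = q * q ^ (m - 1)"
    using m_pos by (cases m) auto
  show ?thesis
  proof (rule ccontr)
    assume "card {x. T x = c} \<noteq> q ^ (m - 1)"
    hence "(\<Sum>d\<in>F. card {x. T x = d}) < (\<Sum>d\<in>F. q ^ (m - 1))"
      using le assms by (intro sum_strict_mono_ex1) (auto intro!: bexI[of _ c] le_neq_trans)
    thus False using sum card_F by simp
  qed
qed

lemma card_trace_affine_eq_0:
  assumes "a \<noteq> 0"
  shows "card {y. T (a * y + b) = 0} = q ^ (m - 1)"
proof -
  have "card {y. T (a * y + b) = 0} = card {x. T x = 0}"
    by (rule bij_betw_same_card[of "\<lambda>y. a * y + b"], rule bij_betw_byWitness[of _ "\<lambda>x. (x - b) / a"])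
      (use assms in auto)
  thus ?thesis using card_trace_fibre is_subfield_zero[OF subfield] by simp
qed

lemma card_trace_affine_neq_0:
  assumes "a \<noteq> 0"
  shows "card {y. T (a * y + b) \<noteq> 0} = q ^ m - q ^ (m - 1)"
proof -
  have "{y. T (a * y + b) \<noteq> 0} = UNIV - {y. T (a * y + b) = 0}" by auto
  thus ?thesis by (simp add: card_Diff_subset card_trace_affine_eq_0[OF assms] CARD_eq)
qed

lemma card_trace_mult_eq_0: "x \<noteq> 0 \<Longrightarrow> card {b. T (b * x) = 0} = q ^ (m - 1)"
  using card_trace_affine_eq_0[of x 0] by (simp add: mult.commute)

text \<open>The kernel is the line spanned by \<open>(v, - u)\<close>, parametrized by its scalar
  multiples.\<close>

lemma card_linear_form_kernel:
  assumes "u \<in> F" "v \<in> F" "u \<noteq> 0 \<or> v \<noteq> 0"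
  shows "card {(c, d). c \<in> F \<and> d \<in> F \<and> c * u + d * v = 0} = q"
proof -
  let ?K = "{(c, d). c \<in> F \<and> d \<in> F \<and> c * u + d * v = 0}"
  have "bij_betw (\<lambda>t. (t * v, - (t * u))) F ?K"
  proof (rule bij_betw_imageI)
    show "inj_on (\<lambda>t. (t * v, - (t * u))) F" using assms(3) by (auto simp: inj_on_def)
    show "(\<lambda>t. (t * v, - (t * u))) ` F = ?K"
    proof (intro equalityI subsetI)
      fix w assume "w \<in> (\<lambda>t. (t * v, - (t * u))) ` F"
      thus "w \<in> ?K" using assms(1,2) subfield
        by (auto simp: is_subfield_mult is_subfield_uminus)
    next
      fix w assume "w \<in> ?K"
      then obtain c d where w: "w = (c, d)" "c \<in> F" "d \<in> F" and "c * u + d * v = 0" by auto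
      hence cd: "c * u = - d * v" by (simp add: eq_neg_iff_add_eq_0)
      show "w \<in> (\<lambda>t. (t * v, - (t * u))) ` F"
      proof (cases "u = 0")
        case True
        hence "v \<noteq> 0" "d = 0" using assms(3) cd by auto
        thus ?thesis using w True assms subfield
          by (intro image_eqI[of _ _ "c / v"]) (auto intro: is_subfield_divide)
      next
        case False
        have "c = c * u / u" using False by simp
        also have "\<dots> = - d / u * v" unfolding cd by simp
        finally have "w = ((- d / u) * v, - ((- d / u) * u))" using w(1) False by simp
        moreover have "- d / u \<in> F"
          using w assms subfield by (intro is_subfield_divide is_subfield_uminus)
        ultimately show ?thesis by (rule image_eqI)
      qed
    qed
  qed
  from bij_betw_same_card[OF this] show ?thesis by (simp only: card_F)
qed

text \<open>Count the triples \<open>(c, d, b)\<close> with \<open>c T(bx) + d T(by) = 0\<close> in two ways.\<close>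

lemma card_trace_mult_both_eq_0:
  assumes "x \<noteq> 0" "y \<notin> (\<lambda>c. c * x) ` F"
  shows "real (card {b. T (b * x) = 0 \<and> T (b * y) = 0}) = real (q ^ m) / real q ^ 2"
proof -
  let ?A = "{b. T (b * x) = 0 \<and> T (b * y) = 0}"
  let ?f = "\<lambda>b w. of_bool (fst w * T (b * x) + snd w * T (b * y) = 0) :: real"
  \<comment> \<open>The two assumptions amount to linear independence of \<open>x\<close> and
    \<open>y\<close> over \<open>F\<close>.\<close>
  have indep: "c * x + d * y \<noteq> 0" if "c \<in> F" "d \<in> F" "(c, d) \<noteq> (0, 0)" for c d
  proof
    assume *: "c * x + d * y = 0"
    have "d \<noteq> 0" using * that assms by auto
    have "d * y = - c * x" using * by (simp add: eq_neg_iff_add_eq_0 add.commute)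
    hence "d * y / d = - c * x / d" by (simp only:)
    hence "y = (- c / d) * x" using \<open>d \<noteq> 0\<close> by simp
    moreover have "- c / d \<in> F" using that subfield
      by (simp add: is_subfield_divide is_subfield_uminus)
    ultimately show False using assms(2) by blast
  qed
  have F0: "(0, 0) \<in> F \<times> F" using is_subfield_zero[OF subfield] by simp
  \<comment> \<open>For fixed \<open>(c, d)\<close>, linearity merges the condition into
    \<open>T (b * (c * x + d * y)) = 0\<close>, a single trace condition that is trivial only for
    \<open>(0, 0)\<close>.\<close>
  have rows: "(\<Sum>b\<in>UNIV. ?f b w) = (if w = (0, 0) then real (q ^ m) else real (q ^ (m - 1)))"
    if "w \<in> F \<times> F" for w
  proof -
    from that obtain c d where w: "w = (c, d)" "c \<in> F" "d \<in> F" by auto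
    have "c * T (b * x) + d * T (b * y) = T (b * (c * x + d * y))" for b
      by (simp only: trace_add distrib_left mult.left_commute[of b] trace_mult w)
    hence "(\<Sum>b\<in>UNIV. ?f b w) = real (card {b. T (b * (c * x + d * y)) = 0})"
      by (simp only: card_Collect_of_bool w fst_conv snd_conv)
    also have "\<dots> = (if w = (0, 0) then real (q ^ m) else real (q ^ (m - 1)))"
      using indep[OF w(2,3)] by (auto simp: w card_trace_mult_eq_0 CARD_eq)
    finally show ?thesis .
  qed
  \<comment> \<open>For fixed \<open>b\<close> the pairs form the kernel of a linear form on
    \<open>F \<times> F\<close>: everything if both traces vanish, a line otherwise.\<close>
  have columns: "(\<Sum>w\<in>F\<times>F. ?f b w) = (if b \<in> ?A then real q ^ 2 else real q)" for b
  proof -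
    have "(\<Sum>w\<in>F\<times>F. ?f b w) = real (card {w\<in>F\<times>F. fst w * T (b * x) + snd w * T (b * y) = 0})"
      by (simp add: of_bool_def sum.If_cases Int_def)
    also have "{w\<in>F\<times>F. fst w * T (b * x) + snd w * T (b * y) = 0} =
        {(c, d). c \<in> F \<and> d \<in> F \<and> c * T (b * x) + d * T (b * y) = 0}" by auto
    also have "real (card \<dots>) = (if b \<in> ?A then real q ^ 2 else real q)"
    proof (cases "b \<in> ?A")
      case True
      hence "{(c, d). c \<in> F \<and> d \<in> F \<and> c * T (b * x) + d * T (b * y) = 0} = F \<times> F" by auto
      thus ?thesis using True by (simp add: card_cartesian_product card_F power2_eq_square)
    next
      case False
      thus ?thesis using card_linear_form_kernel[OF trace_in_F trace_in_F] by auto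
    qed
    finally show ?thesis .
  qed
  have "(\<Sum>w\<in>F\<times>F. \<Sum>b\<in>UNIV. ?f b w) = real (q ^ m) + (real q ^ 2 - 1) * real (q ^ (m - 1))"
  proof -
    have "(\<Sum>w\<in>F\<times>F. \<Sum>b\<in>UNIV. ?f b w)
        = (\<Sum>w\<in>F\<times>F. if w = (0, 0) then real (q ^ m) else real (q ^ (m - 1)))"
      using rows by (intro sum.cong) auto
    also have "\<dots> = real (q ^ m) + (\<Sum>w\<in>F\<times>F - {(0, 0)}. real (q ^ (m - 1)))"
      by (subst sum.remove[OF _ F0]) auto
    also have "(\<Sum>w\<in>F\<times>F - {(0, 0)}. real (q ^ (m - 1))) = (real q ^ 2 - 1) * real (q ^ (m - 1))"
      using F0 q_gt_1 by (simp add: card_Diff_singleton card_cartesian_product card_F of_nat_diff power2_eq_square)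
    finally show ?thesis .
  qed
  moreover have "(\<Sum>w\<in>F\<times>F. \<Sum>b\<in>UNIV. ?f b w) = real (card ?A) * real q ^ 2 + (real (q ^ m) - real (card ?A)) * real q"
  proof -
    have "(\<Sum>w\<in>F\<times>F. \<Sum>b\<in>UNIV. ?f b w) = (\<Sum>b\<in>UNIV. \<Sum>w\<in>F\<times>F. ?f b w)" by (rule sum.swap)
    also have "\<dots> = (\<Sum>b\<in>UNIV. if b \<in> ?A then real q ^ 2 else real q)" by (simp only: columns)
    also have "\<dots> = real (card ?A) * real q ^ 2 + real (card (- ?A)) * real q"
      by (subst sum.If_cases) auto
    also have "real (card (- ?A)) = real (q ^ m) - real (card ?A)"
      using card_mono[of UNIV ?A] by (simp add: card_Diff_subset Compl_eq_Diff_UNIV CARD_eq of_nat_diff)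
    finally show ?thesis .
  qed
  ultimately have "real (card ?A) * (real q * (real q - 1)) = real (q ^ (m - 1)) * (real q - 1)"
    unfolding real_q_m by (simp add: algebra_simps power2_eq_square)
  hence "real (card ?A) * real q = real (q ^ (m - 1))" using q_gt_1 by simp
  thus ?thesis unfolding real_q_m using q_gt_1 by (simp add: field_simps power2_eq_square)
qed

end

section \<open>Squares and the cyclic subgroup\<close>

locale trace_code_setting = finite_field_extension p s q m F
  for p s q m :: nat and F :: "'a::{field,finite} set" +
  fixes \<alpha> :: 'a and e :: nat
  assumes generator: "is_generator \<alpha>"
    and e_pos: "e > 0" and e_dvd: "e dvd q - 1" and gcd_e_m: "gcd e m = 2"
begin

abbreviation "r \<equiv> q ^ m"
abbreviation "H \<equiv> cyclic_subgroup (\<alpha> ^ e)"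

definition squares :: "'a set" where "squares = (\<lambda>y. y ^ 2) ` (UNIV - {0})"

text \<open>This is \<open>(r - 1) / (q - 1)\<close>, the exponent of the norm map onto
  \<open>F\<close> and the index of \<open>F - {0}\<close> among the nonzero elements.\<close>

definition norm_exponent :: nat where "norm_exponent = (\<Sum>i<m. q ^ i)"

section \<open>Discrete logarithms to the base \<alpha>\<close>

lemma generator_nonzero: "\<alpha> \<noteq> 0"
  using generator by (simp add: is_generator_def)

lemma r_gt_1: "r > 1"
  using one_less_power[of q m] q_gt_1 m_pos by simp

lemma real_r_gt_1: "real r > 1"
  using of_nat_less_iff[of 1 r, where 'a = real] r_gt_1 by (simp only: of_nat_1)

lemma generator_power_eq_1: "\<alpha> ^ (r - 1) = 1"
proof -
  have "\<alpha> ^ (r - 1) * \<alpha> = \<alpha> ^ r" using r_gt_1 by (intro power_minus_mult) linarith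
  thus ?thesis using power_CARD[of \<alpha>] generator_nonzero by simp
qed

text \<open>\<open>is_generator\<close> yields an integer exponent, possibly negative; it is reduced
  modulo \<open>r - 1\<close>.\<close>

lemma nonzero_eq_generator_power:
  assumes "x \<noteq> 0" obtains k where "k < r - 1" "x = \<alpha> ^ k"
proof -
  from assms generator have "x \<in> cyclic_subgroup \<alpha>" by (simp add: is_generator_def)
  then obtain i where i: "x = \<alpha> powi i" by (auto simp: cyclic_subgroup_def)
  let ?n = "int (r - 1)"
  have n: "?n > 0" using r_gt_1 by (simp only: of_nat_0_less_iff zero_less_diff)
  have "\<alpha> powi i = \<alpha> powi (?n * (i div ?n) + i mod ?n)" by simp
  also have "\<dots> = (\<alpha> powi ?n) powi (i div ?n) * \<alpha> powi (i mod ?n)"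
    using generator_nonzero by (subst power_int_add) (auto simp only: power_int_mult)
  also have "\<alpha> powi ?n = 1" by (simp only: power_int_of_nat generator_power_eq_1)
  also have "\<alpha> powi (i mod ?n) = \<alpha> ^ nat (i mod ?n)"
    using pos_mod_sign[OF n, of i] by (simp only: power_int_def if_True)
  finally have "x = \<alpha> ^ nat (i mod ?n)" using i by (simp only: power_int_1_left mult_1)
  moreover have "nat (i mod ?n) < r - 1" using n by (simp only: nat_less_iff pos_mod_sign pos_mod_bound)
  ultimately show ?thesis using that by blast
qed

text \<open>There are as many exponents as nonzero elements, so surjectivity forces
  injectivity.\<close>

lemma bij_betw_generator_power: "bij_betw (\<lambda>k. \<alpha> ^ k) {..<r - 1} (UNIV - {0})"
proof -
  have im: "(\<lambda>k. \<alpha> ^ k) ` {..<r - 1} = UNIV - {0}"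
  proof (intro equalityI subsetI)
    fix x assume "x \<in> UNIV - {0 :: 'a}"
    hence "x \<noteq> 0" by simp
    then obtain k where "k < r - 1" "x = \<alpha> ^ k" by (rule nonzero_eq_generator_power)
    thus "x \<in> (\<lambda>k. \<alpha> ^ k) ` {..<r - 1}" by blast
  qed (use generator_nonzero in auto)
  have "card ((\<lambda>k. \<alpha> ^ k) ` {..<r - 1}) = card {..<r - 1}"
    by (subst im) (simp add: CARD_eq)
  hence "inj_on (\<lambda>k. \<alpha> ^ k) {..<r - 1}" by (intro eq_card_imp_inj_on) auto
  thus ?thesis using im by (simp add: bij_betw_def)
qed

lemma generator_power_eq_1_iff: "\<alpha> ^ k = 1 \<longleftrightarrow> r - 1 dvd k"
proof
  assume "\<alpha> ^ k = 1"
  have "\<alpha> ^ k = \<alpha> ^ ((r - 1) * (k div (r - 1)) + k mod (r - 1))" by simp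
  also have "\<dots> = (\<alpha> ^ (r - 1)) ^ (k div (r - 1)) * \<alpha> ^ (k mod (r - 1))"
    by (simp only: power_add power_mult)
  finally have "\<alpha> ^ k = \<alpha> ^ (k mod (r - 1))"
    by (simp only: generator_power_eq_1 power_one mult_1)
  hence eq: "\<alpha> ^ (k mod (r - 1)) = \<alpha> ^ 0" using \<open>\<alpha> ^ k = 1\<close> by simp
  have "k mod (r - 1) = 0"
    by (rule inj_onD[OF bij_betw_imp_inj_on[OF bij_betw_generator_power] eq]) (use r_gt_1 in auto)
  thus "r - 1 dvd k" by (simp add: mod_eq_0_iff_dvd)
next
  assume "r - 1 dvd k"
  then obtain j where "k = (r - 1) * j" by (rule dvdE)
  thus "\<alpha> ^ k = 1" by (simp only: power_mult generator_power_eq_1 power_one)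
qed

section \<open>Odd characteristic and the index of the subfield\<close>

lemma even_e: "even e"
  using gcd_dvd1[of e m] by (simp only: gcd_e_m)

text \<open>The even number \<open>e\<close> divides \<open>q - 1\<close>, so \<open>q\<close> is
  odd and characteristic two is excluded. Hence \<open>x\<close> and \<open>- x\<close> are
  different square roots when \<open>x\<close> is nonzero.\<close>

lemma two_neq_0: "(2::'a) \<noteq> 0"
proof
  assume "(2::'a) = 0"
  hence "of_nat 2 = (0::'a)" by simp
  hence "p dvd 2" using CHAR_eq of_nat_eq_0_iff_char_dvd by blast
  hence "p = 2" by (rule primes_dvd_imp_eq[OF prime_p two_is_prime_nat])
  hence "even q" using s_pos by (simp add: q_def)
  moreover have "even (q - 1)" using even_e e_dvd by (rule dvd_trans)
  ultimately show False using q_gt_1 by simp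
qed

lemma norm_exponent_mult: "(q - 1) * norm_exponent = r - 1"
proof -
  have "(q - 1) * (\<Sum>i<k. q ^ i) + 1 = q ^ k" for k
  proof (induction k)
    case (Suc k)
    have "(q - 1) * (\<Sum>i<Suc k. q ^ i) + 1 = ((q - 1) * (\<Sum>i<k. q ^ i) + 1) + (q - 1) * q ^ k"
      by (simp add: distrib_left)
    also have "\<dots> = q ^ k + (q - 1) * q ^ k" by (simp only: Suc.IH)
    also have "\<dots> = q ^ Suc k" using q_gt_1 by (cases q) auto
    finally show ?case .
  qed simp
  from this[of m] show ?thesis by (simp add: norm_exponent_def)
qed

text \<open>Modulo \<open>e\<close> each of the \<open>m\<close> summands \<open>q ^ i\<close> is 1,
  so \<open>norm_exponent\<close> can be replaced by \<open>m\<close> inside the gcd.\<close>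

lemma gcd_norm_exponent: "gcd norm_exponent e = 2"
proof -
  have "q mod e = 1 mod e" using e_dvd q_gt_1 by (subst mod_eq_dvd_iff_nat) auto
  hence *: "q ^ i mod e = 1 mod e" for i
    by (subst power_mod[symmetric]) (simp only: power_mod power_one)
  hence "norm_exponent mod e = (\<Sum>i<m. 1 mod e) mod e"
    unfolding norm_exponent_def by (subst mod_sum_eq[symmetric]) (simp only: *)
  hence "norm_exponent mod e = m mod e" by (subst (asm) mod_sum_eq) simp
  hence "gcd norm_exponent e = gcd e (m mod e)" by (subst gcd_red_nat) (rule arg_cong)
  also have "\<dots> = gcd m e" by (rule gcd_red_nat[symmetric])
  also have "\<dots> = 2" by (subst gcd.commute) (rule gcd_e_m)
  finally show ?thesis .
qed

lemma e_dvd_r: "e dvd r - 1"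
  using dvd_mult2[OF e_dvd, of norm_exponent] by (simp only: norm_exponent_mult)

section \<open>The subgroup generated by \<open>\<alpha> ^ e\<close>\<close>

lemma cyclic_subgroup_nonzero: "h \<in> H \<Longrightarrow> h \<noteq> 0"
  using generator_nonzero by (auto simp: cyclic_subgroup_def)

lemma cyclic_subgroup_mult: "x \<in> H \<Longrightarrow> y \<in> H \<Longrightarrow> x * y \<in> H"
proof -
  assume "x \<in> H" "y \<in> H"
  then obtain i j where "x = (\<alpha> ^ e) powi i" "y = (\<alpha> ^ e) powi j" by (auto simp: cyclic_subgroup_def)
  hence "x * y = (\<alpha> ^ e) powi (i + j)" using generator_nonzero by (simp add: power_int_add)
  thus ?thesis by (simp add: cyclic_subgroup_def)
qed

lemma cyclic_subgroup_inverse: "x \<in> H \<Longrightarrow> inverse x \<in> H"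
proof -
  assume "x \<in> H"
  then obtain i where "x = (\<alpha> ^ e) powi i" by (auto simp: cyclic_subgroup_def)
  hence "inverse x = (\<alpha> ^ e) powi (- i)" by (simp add: power_int_minus)
  thus ?thesis unfolding cyclic_subgroup_def by (rule range_eqI)
qed

lemma cyclic_subgroup_divide: "x \<in> H \<Longrightarrow> y \<in> H \<Longrightarrow> x / y \<in> H"
  by (simp add: divide_inverse cyclic_subgroup_mult cyclic_subgroup_inverse)

text \<open>For the direction from membership to divisibility, raise to the power
  \<open>(r - 1) div e\<close>: this sends all of \<open>H\<close> to 1, and the order
  \<open>r - 1\<close> of \<alpha> then gives the divisibility after cancellation.\<close>

lemma generator_power_in_cyclic_subgroup_iff: "\<alpha> ^ k \<in> H \<longleftrightarrow> e dvd k"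
proof
  assume "e dvd k"
  then obtain j where "k = e * j" by (auto simp: dvd_def)
  hence "\<alpha> ^ k = (\<alpha> ^ e) powi int j" by (simp add: power_mult)
  thus "\<alpha> ^ k \<in> H" unfolding cyclic_subgroup_def by (rule range_eqI)
next
  assume "\<alpha> ^ k \<in> H"
  then obtain i where "\<alpha> ^ k = (\<alpha> ^ e) powi i" by (auto simp: cyclic_subgroup_def)
  hence "(\<alpha> ^ k) ^ ((r - 1) div e) = ((\<alpha> ^ e) powi i) powi int ((r - 1) div e)"
    by (simp only: power_int_of_nat)
  also have "\<dots> = ((\<alpha> ^ e) ^ ((r - 1) div e)) powi i"
    by (simp only: power_int_mult[symmetric] mult.commute[of i])
      (simp only: power_int_mult power_int_of_nat)
  also have "(\<alpha> ^ e) ^ ((r - 1) div e) = 1"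
    by (simp only: power_mult[symmetric] dvd_mult_div_cancel[OF e_dvd_r] generator_power_eq_1)
  finally have "\<alpha> ^ (k * ((r - 1) div e)) = 1" by (simp add: power_mult)
  hence "e * ((r - 1) div e) dvd k * ((r - 1) div e)"
    using e_dvd_r by (simp add: generator_power_eq_1_iff)
  moreover have "(r - 1) div e \<noteq> 0"
    using e_dvd_r r_gt_1 by (auto simp: dvd_div_eq_0_iff)
  ultimately show "e dvd k" by simp
qed

lemma card_cyclic_subgroup: "real (card H) = (real r - 1) / real e"
proof -
  obtain d where d: "r - 1 = e * d" using e_dvd_r by (auto simp: dvd_def)
  have inj: "inj_on (\<lambda>k. \<alpha> ^ k) {..<r - 1}"
    using bij_betw_generator_power by (simp add: bij_betw_def)
  have "H = (\<lambda>k. \<alpha> ^ k) ` ((\<lambda>j. e * j) ` {..<d})"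
  proof (intro equalityI subsetI)
    fix x assume x: "x \<in> H"
    then obtain k where k: "k < r - 1" "x = \<alpha> ^ k"
      using nonzero_eq_generator_power cyclic_subgroup_nonzero by blast
    with x have "e dvd k" by (simp add: generator_power_in_cyclic_subgroup_iff)
    then obtain j where "k = e * j" by (auto simp: dvd_def)
    thus "x \<in> (\<lambda>k. \<alpha> ^ k) ` ((\<lambda>j. e * j) ` {..<d})" using k d by auto
  qed (auto simp: generator_power_in_cyclic_subgroup_iff)
  moreover have "card ((\<lambda>k. \<alpha> ^ k) ` ((\<lambda>j. e * j) ` {..<d})) = card ((\<lambda>j. e * j) ` {..<d})"
    by (intro card_image inj_on_subset[OF inj]) (use d e_pos in auto)
  moreover have "card ((\<lambda>j. e * j) ` {..<d}) = d"
    using e_pos by (subst card_image) (auto simp: inj_on_def)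
  ultimately have "card H = d" by simp
  moreover have "real r - 1 = real e * real d"
    using of_nat_diff[of 1 r, where 'a = real] r_gt_1 by (simp only: d of_nat_mult of_nat_1)
  ultimately show ?thesis using e_pos by simp
qed

section \<open>Nonzero squares as products from \<open>F\<close> and \<open>H\<close>\<close>

lemma generator_even_power_square: "even k \<Longrightarrow> \<alpha> ^ k \<in> squares"
  using generator_nonzero
  by (auto simp: squares_def image_iff elim!: evenE intro!: bexI[of _ "\<alpha> ^ _"] simp: power_mult mult.commute)

lemma squares_nonzero: "z \<in> squares \<Longrightarrow> z \<noteq> 0"
  by (auto simp: squares_def)

lemma square_mult: "x \<in> squares \<Longrightarrow> y \<in> squares \<Longrightarrow> x * y \<in> squares"
  by (auto simp: squares_def image_iff intro!: bexI[of _ "_ * _"] simp: power_mult_distrib)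

text \<open>An element of order dividing \<open>q - 1\<close> has its exponent divisible by
  \<open>norm_exponent\<close>, which is even by the gcd computation.\<close>

lemma subfield_subset_squares:
  assumes "c \<in> F" "c \<noteq> 0" shows "c \<in> squares"
proof -
  obtain k where k: "c = \<alpha> ^ k" using nonzero_eq_generator_power assms(2) by blast
  have "c * c ^ (q - 1) = c ^ q" using q_gt_1 by (subst power_Suc[symmetric]) simp
  hence "c ^ (q - 1) = 1" using assms F_power_q by simp
  hence "\<alpha> ^ (k * (q - 1)) = 1" by (simp add: k power_mult)
  hence "r - 1 dvd k * (q - 1)" by (simp only: generator_power_eq_1_iff)
  hence "(q - 1) * norm_exponent dvd (q - 1) * k"
    unfolding norm_exponent_mult by (simp only: mult.commute)
  hence "norm_exponent dvd k" using q_gt_1 by simp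
  moreover have "even norm_exponent" using gcd_dvd1[of norm_exponent e] by (simp only: gcd_norm_exponent)
  ultimately have "even k" by (rule dvd_trans[rotated])
  thus ?thesis by (simp add: k generator_even_power_square)
qed

lemma cyclic_subgroup_subset_squares:
  assumes "h \<in> H" shows "h \<in> squares"
proof -
  obtain k where k: "h = \<alpha> ^ k" using nonzero_eq_generator_power cyclic_subgroup_nonzero assms by blast
  hence "e dvd k" using assms by (simp add: generator_power_in_cyclic_subgroup_iff)
  thus ?thesis using even_e k generator_even_power_square dvd_trans by blast
qed

text \<open>A Bezout relation between \<open>norm_exponent\<close> and \<open>e\<close> writes \<open>\<alpha>\<^sup>2\<close> as a product of a power
  of \<open>\<alpha> ^ norm_exponent\<close>, which lies in \<open>F\<close>, and of a power of \<open>\<alpha> ^ e\<close>.\<close>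

lemma square_decomposition:
  assumes "z \<in> squares"
  obtains c h where "c \<in> F" "c \<noteq> 0" "h \<in> H" "z = c * h"
proof -
  obtain y where y: "y \<noteq> 0" "z = y ^ 2" using assms by (auto simp: squares_def)
  obtain k where k: "y = \<alpha> ^ k" using nonzero_eq_generator_power y(1) by blast
  obtain a b where ab: "a * int norm_exponent + b * int e = 2"
    using bezout_int[of "int norm_exponent" "int e"]
    by (auto simp only: gcd_int_int_eq gcd_norm_exponent of_nat_numeral)
  \<comment> \<open>The Bezout coefficients may be negative, hence \<open>powi\<close>. They are
    scaled by \<open>k\<close> because \<open>z\<close> is
    \<open>\<alpha> ^ (2 * k)\<close>.\<close>
  let ?c = "(\<alpha> ^ norm_exponent) powi (int k * a)" and ?h = "(\<alpha> ^ e) powi (int k * b)"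
  have "(\<alpha> ^ norm_exponent) ^ q = \<alpha> ^ (norm_exponent + (q - 1) * norm_exponent)"
  proof -
    have "norm_exponent * q = norm_exponent + (q - 1) * norm_exponent"
      using q_gt_1 by (cases q) auto
    thus ?thesis by (simp only: power_mult[symmetric])
  qed
  also have "\<dots> = \<alpha> ^ norm_exponent" by (simp only: power_add norm_exponent_mult generator_power_eq_1 mult_1_right)
  finally have "\<alpha> ^ norm_exponent \<in> F" by (subst F_eq) simp
  hence "?c \<in> F" by (intro is_subfield_power_int subfield)
  moreover have "?c \<noteq> 0" using generator_nonzero by simp
  moreover have "?h \<in> H" by (simp add: cyclic_subgroup_def)
  moreover have "z = ?c * ?h"
  proof -
    have "?c * ?h = \<alpha> powi (int norm_exponent * (int k * a) + int e * (int k * b))"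
      using generator_nonzero by (simp add: power_int_add power_int_mult)
    also have "int norm_exponent * (int k * a) + int e * (int k * b) = int k * (a * int norm_exponent + b * int e)"
      by (simp add: algebra_simps)
    also have "\<dots> = int (k * 2)" by (simp add: ab)
    finally show ?thesis by (simp only: power_int_of_nat power_mult y k)
  qed
  ultimately show ?thesis using that by blast
qed

text \<open>Squaring is two-to-one on nonzero elements: the fibre through \<open>x\<close> is
  \<open>{x, - x}\<close>.\<close>

lemma sum_over_nonzero_square:
  fixes g :: "'a \<Rightarrow> real"
  shows "(\<Sum>y\<in>UNIV - {0}. g (y ^ 2)) = 2 * (\<Sum>z\<in>squares. g z)"
proof -
  have two: "card {y \<in> UNIV - {0}. y ^ 2 = z} = 2" if "z \<in> squares" for z
  proof -
    from that obtain x where x: "x \<noteq> 0" "z = x ^ 2" by (auto simp: squares_def)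
    have "x \<noteq> - x"
    proof
      assume "x = - x"
      hence "x + x = 0" by (simp only: eq_neg_iff_add_eq_0)
      hence "2 * x = 0" by (simp only: mult_2)
      thus False using x two_neq_0 by simp
    qed
    moreover have "{y \<in> UNIV - {0}. y ^ 2 = z} = {x, - x}"
      using x by (auto simp: power2_eq_iff)
    ultimately show ?thesis by simp
  qed
  have "(\<Sum>y\<in>UNIV - {0}. g (y ^ 2)) = (\<Sum>z\<in>squares. \<Sum>y\<in>{y \<in> UNIV - {0}. y ^ 2 = z}. g (y ^ 2))"
    by (rule sum.group[symmetric]) (auto simp: squares_def)
  also have "\<dots> = (\<Sum>z\<in>squares. 2 * g z)"
  proof (rule sum.cong)
    fix z assume "z \<in> squares"
    have "(\<Sum>y\<in>{y \<in> UNIV - {0}. y ^ 2 = z}. g (y ^ 2)) = (\<Sum>y\<in>{y \<in> UNIV - {0}. y ^ 2 = z}. g z)"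
      by (rule sum.cong) auto
    thus "(\<Sum>y\<in>{y \<in> UNIV - {0}. y ^ 2 = z}. g (y ^ 2)) = 2 * g z"
      by (simp add: two[OF \<open>z \<in> squares\<close>, simplified])
  qed simp
  finally show ?thesis by (simp add: sum_distrib_left)
qed

lemma card_squares: "real (card squares) = (real r - 1) / 2"
  using sum_over_nonzero_square[of "\<lambda>_. 1"] r_gt_1 by (simp add: CARD_eq of_nat_diff)

text \<open>Multiplication maps \<open>(F - {0}) \<times> H\<close> onto \<open>squares\<close> with
  all fibres of size \<open>card (F \<inter> H)\<close>. Summing \<open>g\<close> over the products
  gives a multiple of the sum over \<open>squares\<close>; by invariance it also gives
  \<open>q - 1\<close> times the sum over \<open>H\<close>.\<close>

lemma sum_over_cyclic_subgroup:
  fixes g :: "'a \<Rightarrow> real"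
  assumes inv: "\<And>c x. c \<in> F \<Longrightarrow> c \<noteq> 0 \<Longrightarrow> g (c * x) = g x"
  shows "real e * (\<Sum>h\<in>H. g h) = (\<Sum>y\<in>UNIV - {0}. g (y ^ 2))"
proof -
  let ?X = "(F - {0}) \<times> H" and ?k = "card (F \<inter> H)"
  have fibre: "card {w \<in> ?X. fst w * snd w = z} = ?k" if "z \<in> squares" for z
  proof -
    from that obtain c h where ch: "c \<in> F" "c \<noteq> 0" "h \<in> H" "z = c * h"
      by (rule square_decomposition)
    have h: "h \<noteq> 0" using ch cyclic_subgroup_nonzero by blast
    \<comment> \<open>Two factorizations of the same \<open>z\<close> differ by an element
      \<open>d\<close> that lies in both subgroups.\<close>
    have "bij_betw (\<lambda>d. (c * d, h / d)) (F \<inter> H) {w \<in> ?X. fst w * snd w = z}"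
    proof (rule bij_betw_imageI)
      show "inj_on (\<lambda>d. (c * d, h / d)) (F \<inter> H)" using ch by (auto simp: inj_on_def)
      show "(\<lambda>d. (c * d, h / d)) ` (F \<inter> H) = {w \<in> ?X. fst w * snd w = z}"
      proof (intro equalityI subsetI)
        fix w assume "w \<in> (\<lambda>d. (c * d, h / d)) ` (F \<inter> H)"
        thus "w \<in> {w \<in> ?X. fst w * snd w = z}"
          using ch subfield by (auto simp: is_subfield_mult cyclic_subgroup_divide dest: cyclic_subgroup_nonzero)
      next
        fix w assume "w \<in> {w \<in> ?X. fst w * snd w = z}"
        moreover obtain c' h' where "w = (c', h')" by (cases w)
        ultimately have w: "w = (c', h')" "c' \<in> F" "c' \<noteq> 0" "h' \<in> H" "c' * h' = c * h"
          using ch by auto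
        hence h': "h' \<noteq> 0" using cyclic_subgroup_nonzero by blast
        have eq: "c' / c = h / h'" using w(5) ch(2) h' by (simp add: frac_eq_eq mult.commute)
        have "c' / c \<in> F" using w ch subfield by (simp add: is_subfield_divide)
        moreover have "c' / c \<in> H" unfolding eq using w ch by (simp add: cyclic_subgroup_divide)
        moreover have "h / (c' / c) = h'" unfolding eq using h h' by simp
        moreover have "c * (c' / c) = c'" using ch by simp
        ultimately show "w \<in> (\<lambda>d. (c * d, h / d)) ` (F \<inter> H)"
          using w(1) by (intro image_eqI[of _ _ "c' / c"]) auto
      qed
    qed
    from bij_betw_same_card[OF this] show ?thesis by simp
  qed
  have image: "fst w * snd w \<in> squares" if "w \<in> ?X" for w
    using that
    by (intro square_mult) (auto intro: subfield_subset_squares cyclic_subgroup_subset_squares)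
  have group: "(\<Sum>w\<in>?X. f (fst w * snd w)) = real ?k * (\<Sum>z\<in>squares. f z)" for f :: "'a \<Rightarrow> real"
  proof -
    have "(\<Sum>w\<in>?X. f (fst w * snd w)) = (\<Sum>z\<in>squares. \<Sum>w\<in>{w \<in> ?X. fst w * snd w = z}. f (fst w * snd w))"
      using image by (intro sum.group[symmetric]) auto
    also have "\<dots> = (\<Sum>z\<in>squares. real ?k * f z)"
    proof (rule sum.cong)
      fix z assume "z \<in> squares"
      have "(\<Sum>w\<in>{w \<in> ?X. fst w * snd w = z}. f (fst w * snd w)) = (\<Sum>w\<in>{w \<in> ?X. fst w * snd w = z}. f z)"
        by (rule sum.cong) auto
      thus "(\<Sum>w\<in>{w \<in> ?X. fst w * snd w = z}. f (fst w * snd w)) = real ?k * f z"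
        by (simp only: sum_constant fibre[OF \<open>z \<in> squares\<close>])
    qed simp
    finally show ?thesis by (simp add: sum_distrib_left)
  qed
  have F0: "card (F - {0}) = q - 1" using is_subfield_zero[OF subfield] by (simp add: card_F)
  \<comment> \<open>The constant function 1 determines the fibre size:
    \<open>e * card (F \<inter> H) = 2 * (q - 1)\<close>.\<close>
  have "real (card ?X) = real ?k * real (card squares)" using group[of "\<lambda>_. 1"] by simp
  hence k0: "(real q - 1) * ((real r - 1) / real e) = real ?k * ((real r - 1) / 2)"
    unfolding card_squares using q_gt_1
    by (simp add: card_cartesian_product F0 of_nat_diff card_cyclic_subgroup)
  have r1: "real r - 1 \<noteq> 0" using real_r_gt_1 by linarith
  have "2 * a = c * d" if "a * (t / c) = d * (t / 2)" "t \<noteq> 0" "c \<noteq> 0" for a c d t :: real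
    using that by (simp add: divide_eq_eq eq_divide_eq mult_ac)
  from this[OF k0 r1] e_pos have k: "2 * (real q - 1) = real e * real ?k" by simp
  have "real ?k * (\<Sum>z\<in>squares. g z) = (\<Sum>w\<in>?X. g (fst w * snd w))" by (rule group[symmetric])
  also have "\<dots> = (\<Sum>c\<in>F - {0}. \<Sum>h\<in>H. g (c * h))"
    by (simp only: sum.cartesian_product split_def)
  also have "\<dots> = (\<Sum>c\<in>F - {0}. \<Sum>h\<in>H. g h)" using inv by (intro sum.cong refl) auto
  also have "\<dots> = (real q - 1) * (\<Sum>h\<in>H. g h)" using q_gt_1 by (simp add: F0 of_nat_diff)
  finally have "(real q - 1) * (real e * (\<Sum>h\<in>H. g h)) = (real e * real ?k) * (\<Sum>z\<in>squares. g z)"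
    by simp
  also have "\<dots> = (real q - 1) * (2 * (\<Sum>z\<in>squares. g z))" unfolding k[symmetric] by simp
  finally have "real e * (\<Sum>h\<in>H. g h) = 2 * (\<Sum>z\<in>squares. g z)" using q_gt_1 by simp
  thus ?thesis by (simp only: sum_over_nonzero_square)
qed

definition N :: "'a \<Rightarrow> real" where "N b = real (card {y. T (b * y ^ 2) = 0})"

text \<open>Nonvanishing of \<open>T (b * x)\<close> is invariant under scaling by
  \<open>F - {0}\<close>, so the averaging identity applies. Since \<open>y = 0\<close> is always a
  zero of \<open>T (b * y ^ 2)\<close>, the sum extends to all \<open>y\<close> and counts the
  complement of the zeros.\<close>

lemma card_trace_cyclic_subgroup:
  "real e * real (card {h \<in> H. T (b * h) \<noteq> 0}) = real r - N b"
proof -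
  let ?g = "\<lambda>x. of_bool (T (b * x) \<noteq> 0) :: real"
  have "real e * real (card {h \<in> H. T (b * h) \<noteq> 0}) = real e * (\<Sum>h\<in>H. ?g h)"
    by (simp add: of_bool_def sum.If_cases Int_def)
  also have "\<dots> = (\<Sum>y\<in>UNIV - {0}. ?g (y ^ 2))"
  proof (rule sum_over_cyclic_subgroup)
    fix c x assume c: "c \<in> F" "c \<noteq> 0"
    have "T (b * (c * x)) = c * T (b * x)"
      by (simp only: mult.left_commute[of b] trace_mult[OF c(1)])
    thus "?g (c * x) = ?g x" using c by simp
  qed
  also have "\<dots> = (\<Sum>y\<in>UNIV. 1 - of_bool (T (b * y ^ 2) = 0))"
    by (rule sum.mono_neutral_cong_left) auto
  also have "\<dots> = real r - N b"
    by (simp only: sum_subtractf N_def card_Collect_of_bool) (simp add: CARD_eq)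
  finally show ?thesis .
qed

section \<open>Zeros of quadratic trace forms\<close>

lemma N_0: "N 0 = real r"
  by (simp add: N_def CARD_eq)

lemma N_mult_square:
  assumes "x \<noteq> 0" shows "N (b * x ^ 2) = N b"
proof -
  have "bij_betw (\<lambda>y. x * y) {y. T (b * x ^ 2 * y ^ 2) = 0} {y. T (b * y ^ 2) = 0}"
    by (rule bij_betw_byWitness[of _ "\<lambda>y. y / x"])
      (use assms in \<open>auto simp: power_mult_distrib power_divide mult.assoc\<close>)
  from bij_betw_same_card[OF this] show ?thesis by (simp only: N_def)
qed

lemma N_square: "b \<in> squares \<Longrightarrow> N b = N 1"
  using N_mult_square[of _ 1] by (auto simp: squares_def)

lemma N_nonsquare:
  assumes "b \<noteq> 0" "b \<notin> squares" shows "N b = N \<alpha>"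
proof -
  obtain k where k: "b = \<alpha> ^ k" using assms(1) by (rule nonzero_eq_generator_power)
  hence "odd k" using assms(2) generator_even_power_square by blast
  then obtain j where "k = 2 * j + 1" by (rule oddE)
  hence "b = \<alpha> * (\<alpha> ^ j) ^ 2" by (simp add: k power_mult power_mult_distrib power2_eq_square power_add mult_2)
  thus ?thesis using N_mult_square[of "\<alpha> ^ j" \<alpha>] generator_nonzero by simp
qed

lemma card_nonsquares: "real (card (UNIV - {0} - squares)) = (real r - 1) / 2"
proof -
  have "squares \<subseteq> UNIV - {0}" using squares_nonzero by auto
  hence "card (UNIV - {0} - squares) + card squares = card (UNIV - {0 :: 'a})"
    using card_mono[of "UNIV - {0}" squares] by (simp add: card_Diff_subset)
  also have "\<dots> = r - 1" by (simp add: CARD_eq)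
  finally have "real (card (UNIV - {0} - squares)) + real (card squares) = real r - 1"
    using of_nat_diff[of 1 r, where 'a = real] r_gt_1 by (simp only: flip: of_nat_add)
  thus ?thesis by (simp add: card_squares field_simps)
qed

text \<open>With \<open>h\<close> the identity and then the square, this turns the first two moments
  of \<open>N\<close> into symmetric equations in \<open>N 1\<close> and
  \<open>N \<alpha>\<close>.\<close>

lemma sum_over_square_classes:
  fixes h :: "real \<Rightarrow> real"
  shows "(\<Sum>b\<in>UNIV. h (N b)) = h (real r) + (real r - 1) / 2 * (h (N 1) + h (N \<alpha>))"
proof -
  have sub: "squares \<subseteq> UNIV - {0}" using squares_nonzero by auto
  have "(\<Sum>b\<in>UNIV. h (N b)) = h (N 0) + (\<Sum>b\<in>UNIV - {0}. h (N b))"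
    by (rule sum.remove) auto
  also have "(\<Sum>b\<in>UNIV - {0}. h (N b)) = (\<Sum>b\<in>UNIV - {0} - squares. h (N b)) + (\<Sum>b\<in>squares. h (N b))"
    by (rule sum.subset_diff[OF sub]) simp
  also have "(\<Sum>b\<in>squares. h (N b)) = (\<Sum>b\<in>squares. h (N 1))"
    by (rule sum.cong) (simp_all only: N_square)
  also have "(\<Sum>b\<in>UNIV - {0} - squares. h (N b)) = (\<Sum>b\<in>UNIV - {0} - squares. h (N \<alpha>))"
  proof (rule sum.cong)
    fix b assume "b \<in> UNIV - {0} - squares"
    hence "N b = N \<alpha>" by (intro N_nonsquare) auto
    thus "h (N b) = h (N \<alpha>)" by simp
  qed simp
  finally show ?thesis
    by (simp only: N_0 sum_constant card_squares card_nonsquares distrib_left add_ac)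
qed

section \<open>The first two moments of \<open>N\<close>\<close>

lemma card_trace_fibre_real: "real (q ^ (m - 1)) = real r / real q"
  using real_q_m q_gt_1 by (simp only: nonzero_eq_divide_eq) (simp add: mult.commute)

lemma sum_trace_kernel_mult:
  "(\<Sum>b\<in>UNIV. of_bool (T (b * x) = 0)) = (if x = 0 then real r else real r / real q)"
proof (cases "x = 0")
  case True
  thus ?thesis by (simp add: CARD_eq)
next
  case False
  thus ?thesis
    unfolding card_Collect_of_bool[symmetric]
    by (simp only: card_trace_mult_eq_0[OF False] card_trace_fibre_real if_False)
qed

text \<open>Count the pairs \<open>(b, y)\<close> with \<open>T (b * y ^ 2) = 0\<close> by
  \<open>y\<close>: all \<open>r\<close> values of \<open>b\<close> for \<open>y = 0\<close>, and
  \<open>r / q\<close> of them otherwise.\<close>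

lemma N_sum: "N 1 + N \<alpha> = 2 * real r / real q"
proof -
  have "(\<Sum>b\<in>UNIV. N b) = (\<Sum>b\<in>UNIV. \<Sum>y\<in>UNIV. of_bool (T (b * y ^ 2) = 0))"
    by (simp only: N_def card_Collect_of_bool)
  also have "\<dots> = (\<Sum>y\<in>UNIV. \<Sum>b\<in>UNIV. of_bool (T (b * y ^ 2) = 0))" by (rule sum.swap)
  also have "\<dots> = (\<Sum>y::'a\<in>UNIV. if y = 0 then real r else real r / real q)"
    by (simp only: sum_trace_kernel_mult power2_eq_square mult_eq_0_iff disj_absorb)
  also have "\<dots> = real r + (\<Sum>y\<in>UNIV - {0::'a}. real r / real q)"
    by (subst sum.remove[of _ 0]) (auto intro!: sum.cong)
  also have "\<dots> = real r + (real r - 1) * (real r / real q)"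
    using of_nat_diff[of 1 r, where 'a = real] r_gt_1 by (simp add: CARD_eq)
  finally have "(real r - 1) / 2 * (N 1 + N \<alpha>) = (real r - 1) / 2 * (2 * real r / real q)"
    using sum_over_square_classes[of "\<lambda>x. x"] by simp
  thus ?thesis using real_r_gt_1 by (simp only: mult_cancel_left) simp
qed

text \<open>Dividing by \<open>y\<close> reduces to counting \<open>w\<close> with
  \<open>w ^ 2\<close> in \<open>F\<close>. The root 0 counts once, and each of the
  \<open>q - 1\<close> nonzero elements of \<open>F\<close> is a square with two roots:
  \<open>1 + 2 * (q - 1)\<close>.\<close>

lemma card_square_proportional:
  assumes "y \<noteq> 0"
  shows "real (card {z. z ^ 2 \<in> (\<lambda>c. c * y ^ 2) ` F}) = 2 * real q - 1"
proof -
  let ?Z = "{z. z ^ 2 \<in> (\<lambda>c. c * y ^ 2) ` F}"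
  have "bij_betw (\<lambda>w. w * y) {w. w ^ 2 \<in> F} ?Z"
  proof (rule bij_betw_byWitness[of _ "\<lambda>z. z / y"])
    show "(\<lambda>w. w * y) ` {w. w ^ 2 \<in> F} \<subseteq> ?Z" by (auto simp: power_mult_distrib)
    show "(\<lambda>z. z / y) ` ?Z \<subseteq> {w. w ^ 2 \<in> F}" using assms by (auto simp: power_divide)
  qed (use assms in auto)
  from bij_betw_same_card[OF this] have "real (card ?Z) = real (card {w. w ^ 2 \<in> F})" by simp
  also have "\<dots> = (\<Sum>w\<in>UNIV. of_bool (w ^ 2 \<in> F))" by (rule card_Collect_of_bool)
  also have "\<dots> = of_bool ((0::'a) ^ 2 \<in> F) + (\<Sum>w\<in>UNIV - {0}. of_bool (w ^ 2 \<in> F))"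
    by (rule sum.remove) auto
  also have "of_bool ((0::'a) ^ 2 \<in> F) = (1::real)" using is_subfield_zero[OF subfield] by simp
  also have "(\<Sum>w\<in>UNIV - {0}. of_bool (w ^ 2 \<in> F)) = 2 * (\<Sum>z\<in>squares. of_bool (z \<in> F) :: real)"
    by (rule sum_over_nonzero_square)
  also have "(\<Sum>z\<in>squares. of_bool (z \<in> F) :: real) = real (card (squares \<inter> F))"
    by (simp add: of_bool_def sum.If_cases)
  also have "squares \<inter> F = F - {0}" using subfield_subset_squares squares_nonzero by auto
  also have "real (card (F - {0})) = real q - 1"
    using is_subfield_zero[OF subfield] q_gt_1 by (simp add: card_F of_nat_diff)
  finally show ?thesis by simp
qed

text \<open>Count the triples \<open>(b, y, z)\<close> with both traces zero. For
  \<open>y = 0\<close> this is the first moment again. For each other \<open>y\<close>,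
  \<open>2 * q - 1\<close> values of \<open>z\<close> give dependent conditions with
  \<open>r / q\<close> solutions \<open>b\<close>; the remaining \<open>z\<close> give independent
  ones with \<open>r / q ^ 2\<close>.\<close>

lemma N_sum_squares:
  "(N 1) ^ 2 + (N \<alpha>) ^ 2 = 2 * real r * ((real q - 1) ^ 2 + real r) / real q ^ 2"
proof -
  let ?R = "real r" and ?Q = "real q"
  let ?A = "\<lambda>x y. \<Sum>b\<in>UNIV. of_bool (T (b * x) = 0) * of_bool (T (b * y) = 0) :: real"
  have A0: "?A 0 x = (if x = 0 then ?R else ?R / ?Q)" for x
    using sum_trace_kernel_mult[of x] by simp
  have A: "?A x y = (if y \<in> (\<lambda>c. c * x) ` F then ?R / ?Q else ?R / ?Q ^ 2)" if "x \<noteq> 0" for x y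
  proof (cases "y \<in> (\<lambda>c. c * x) ` F")
    case True
    then obtain c where c: "c \<in> F" "y = c * x" by auto
    have "T (b * y) = c * T (b * x)" for b
      by (simp only: c(2) mult.left_commute[of b] trace_mult[OF c(1)])
    hence "?A x y = (\<Sum>b\<in>UNIV. of_bool (T (b * x) = 0))" by (intro sum.cong) auto
    thus ?thesis using True that sum_trace_kernel_mult[of x] by simp
  next
    case False
    have "?A x y = real (card {b. T (b * x) = 0 \<and> T (b * y) = 0})"
      by (simp only: card_Collect_of_bool of_bool_conj)
    also have "\<dots> = ?R / ?Q ^ 2" by (rule card_trace_mult_both_eq_0[OF that False])
    finally show ?thesis using False by simp
  qed
  have "(\<Sum>b\<in>UNIV. (N b) ^ 2) =
      (\<Sum>b\<in>UNIV. \<Sum>y\<in>UNIV. \<Sum>z\<in>UNIV. of_bool (T (b * y ^ 2) = 0) * of_bool (T (b * z ^ 2) = 0))"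
    by (simp only: N_def card_Collect_of_bool power2_eq_square[of "sum _ _"] sum_product)
  also have "\<dots> = (\<Sum>y\<in>UNIV. \<Sum>b\<in>UNIV. \<Sum>z\<in>UNIV. of_bool (T (b * y ^ 2) = 0) * of_bool (T (b * z ^ 2) = 0))"
    by (rule sum.swap)
  also have "\<dots> = (\<Sum>y\<in>UNIV. \<Sum>z\<in>UNIV. ?A (y ^ 2) (z ^ 2))"
    by (rule sum.cong[OF refl], rule sum.swap)
  also have "\<dots> = (\<Sum>z\<in>UNIV. ?A (0 ^ 2) (z ^ 2)) + (\<Sum>y\<in>UNIV - {0}. \<Sum>z\<in>UNIV. ?A (y ^ 2) (z ^ 2))"
    by (rule sum.remove) auto
  also have "(\<Sum>z::'a\<in>UNIV. ?A (0 ^ 2) (z ^ 2)) = ?R + (?R - 1) * (?R / ?Q)"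
  proof -
    have "(\<Sum>z::'a\<in>UNIV. ?A (0 ^ 2) (z ^ 2)) = (\<Sum>z::'a\<in>UNIV. if z = 0 then ?R else ?R / ?Q)"
      by (simp only: zero_power2 A0 zero_eq_power2)
    also have "\<dots> = ?R + (\<Sum>z\<in>UNIV - {0::'a}. ?R / ?Q)"
      by (subst sum.remove[of _ 0]) (auto intro!: sum.cong)
    also have "\<dots> = ?R + (?R - 1) * (?R / ?Q)"
      using of_nat_diff[of 1 r, where 'a = real] r_gt_1 by (simp add: CARD_eq)
    finally show ?thesis .
  qed
  also have "(\<Sum>y\<in>UNIV - {0}. \<Sum>z\<in>UNIV. ?A (y ^ 2) (z ^ 2)) =
      (\<Sum>y\<in>UNIV - {0::'a}. (2 * ?Q - 1) * (?R / ?Q) + (?R - (2 * ?Q - 1)) * (?R / ?Q ^ 2))"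
  proof (rule sum.cong)
    fix y :: 'a assume "y \<in> UNIV - {0}"
    hence y: "y \<noteq> 0" by simp
    let ?Z = "{z. z ^ 2 \<in> (\<lambda>c. c * y ^ 2) ` F}"
    have "(\<Sum>z\<in>UNIV. ?A (y ^ 2) (z ^ 2)) = (\<Sum>z\<in>UNIV. if z \<in> ?Z then ?R / ?Q else ?R / ?Q ^ 2)"
      using A[of "y ^ 2"] y by (intro sum.cong) auto
    also have "\<dots> = real (card ?Z) * (?R / ?Q) + real (card (- ?Z)) * (?R / ?Q ^ 2)"
      by (subst sum.If_cases) (simp_all only: finite Int_UNIV_left sum_constant Collect_mem_eq Compl_eq)
    also have "real (card (- ?Z)) = ?R - real (card ?Z)"
      using card_mono[of UNIV ?Z]
      by (simp add: card_Diff_subset Compl_eq_Diff_UNIV CARD_eq of_nat_diff del: of_nat_power)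
    also have "real (card ?Z) = 2 * ?Q - 1" by (rule card_square_proportional[OF y])
    finally show "(\<Sum>z\<in>UNIV. ?A (y ^ 2) (z ^ 2)) =
      (2 * ?Q - 1) * (?R / ?Q) + (?R - (2 * ?Q - 1)) * (?R / ?Q ^ 2)" .
  qed simp
  also have "\<dots> = (?R - 1) * ((2 * ?Q - 1) * (?R / ?Q) + (?R - (2 * ?Q - 1)) * (?R / ?Q ^ 2))"
    using of_nat_diff[of 1 r, where 'a = real] r_gt_1 by (simp add: CARD_eq)
  finally have *: "?R ^ 2 + (?R - 1) / 2 * ((N 1) ^ 2 + (N \<alpha>) ^ 2) =
      ?R + (?R - 1) * (?R / ?Q) + (?R - 1) * ((2 * ?Q - 1) * (?R / ?Q) + (?R - (2 * ?Q - 1)) * (?R / ?Q ^ 2))"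
    by (rule trans[OF sum_over_square_classes[of "\<lambda>x. x ^ 2", symmetric]])
  \<comment> \<open>Solving for the sum of squares is done over abstract reals, with
    \<open>r\<close> as an atom instead of the power \<open>q ^ m\<close>.\<close>
  have solve: "S = 2 * R * ((Q - 1) ^ 2 + R) / Q ^ 2"
    if "R ^ 2 + (R - 1) / 2 * S =
      R + (R - 1) * (R / Q) + (R - 1) * ((2 * Q - 1) * (R / Q) + (R - (2 * Q - 1)) * (R / Q ^ 2))"
      "R > 1" "Q > 1" for R Q S :: real
  proof -
    have "R + (R - 1) * (R / Q) + (R - 1) * ((2 * Q - 1) * (R / Q) + (R - (2 * Q - 1)) * (R / Q ^ 2)) - R ^ 2
        = (R - 1) / 2 * (2 * R * ((Q - 1) ^ 2 + R) / Q ^ 2)"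
      using \<open>Q > 1\<close> by (simp add: field_simps power2_eq_square)
    hence "(R - 1) / 2 * S = (R - 1) / 2 * (2 * R * ((Q - 1) ^ 2 + R) / Q ^ 2)"
      using that(1) by linarith
    thus ?thesis using \<open>R > 1\<close> by (simp only: mult_cancel_left) simp
  qed
  show ?thesis by (rule solve[OF *]) (use real_r_gt_1 q_gt_1 in auto)
qed

text \<open>Write the two values as \<open>r / q + x\<close> and \<open>r / q - x\<close>; the sum
  of squares fixes \<open>x ^ 2\<close> and leaves the sign open. \<open>P\<close> is the square
  class with the larger value, whichever it is.\<close>

lemma N_distribution:
  obtains P where "P \<subseteq> UNIV - {0}" "real (card P) = (real r - 1) / 2"
    "real (card (UNIV - {0} - P)) = (real r - 1) / 2"
    "\<And>b. b \<in> P \<Longrightarrow> N b = real r / real q + sqrt (real r) * (real q - 1) / real q"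
    "\<And>b. b \<notin> P \<Longrightarrow> b \<noteq> 0 \<Longrightarrow> N b = real r / real q - sqrt (real r) * (real q - 1) / real q"
proof -
  define d where "d = sqrt (real r) * (real q - 1) / real q"
  have solve: "u = R / Q + D \<and> v = R / Q - D \<or> u = R / Q - D \<and> v = R / Q + D"
    if "u + v = 2 * R / Q" "u ^ 2 + v ^ 2 = 2 * R * ((Q - 1) ^ 2 + R) / Q ^ 2" "Q > 1"
      "D ^ 2 = R * (Q - 1) ^ 2 / Q ^ 2" for u v R Q D :: real
  proof -
    define x where "x = u - R / Q"
    have u: "u = R / Q + x" and v: "v = R / Q - x" using that(1) by (auto simp: x_def)
    have "2 * (R / Q) ^ 2 + 2 * x ^ 2 = 2 * R * ((Q - 1) ^ 2 + R) / Q ^ 2"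
      using that(2) by (simp add: u v power2_eq_square algebra_simps)
    also have "\<dots> = 2 * (R / Q) ^ 2 + 2 * (R * (Q - 1) ^ 2 / Q ^ 2)"
      using that(3) by (simp add: field_simps power2_eq_square)
    finally have "x ^ 2 = D ^ 2" using that(4) by simp
    hence "x = D \<or> x = - D" by (simp only: power2_eq_iff)
    thus ?thesis using u v by auto
  qed
  have "d ^ 2 = real r * (real q - 1) ^ 2 / real q ^ 2"
    by (simp add: d_def power_divide power_mult_distrib)
  from solve[OF N_sum N_sum_squares _ this] q_gt_1
  have cases: "N 1 = real r / real q + d \<and> N \<alpha> = real r / real q - d \<or>
      N 1 = real r / real q - d \<and> N \<alpha> = real r / real q + d" by simp
  have sq: "squares \<subseteq> UNIV - {0}" using squares_nonzero by auto
  from cases show ?thesis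
  proof
    assume *: "N 1 = real r / real q + d \<and> N \<alpha> = real r / real q - d"
    show ?thesis
      by (rule that[of squares, folded d_def])
        (use * sq card_squares card_nonsquares N_square N_nonsquare in auto)
  next
    assume *: "N 1 = real r / real q - d \<and> N \<alpha> = real r / real q + d"
    \<comment> \<open>Here \<open>P\<close> consists of the nonsquares, so its complement among the
      nonzero elements is the set of squares.\<close>
    have "UNIV - {0} - (UNIV - {0} - squares) = squares" using sq by auto
    thus ?thesis
      by (intro that[of "UNIV - {0} - squares", folded d_def])
        (use * card_squares card_nonsquares N_square N_nonsquare in auto)
  qed
qed

end

section \<open>Lee weights of the trace code\<close>

lemma sum_monom_const: "(\<Sum>x\<in>A. monom 1 w) = (monom (real (card A)) w :: real poly)"
  by (simp add: of_nat_poly smult_monom monom_0[symmetric] mult_monom)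

lemma lee_weight_eq:
  assumes "finite I"
  shows "lee_weight I c = card {i \<in> I. u_part (c i) \<noteq> 0} + card {i \<in> I. base_part (c i) + u_part (c i) \<noteq> 0}"
proof -
  have "{j \<in> I <+> I. gray I c j \<noteq> 0} =
      {i \<in> I. u_part (c i) \<noteq> 0} <+> {i \<in> I. base_part (c i) + u_part (c i) \<noteq> 0}"
    by (auto simp: gray_def)
  thus ?thesis using assms by (simp add: lee_weight_def hamming_weight_def card_Plus)
qed

context trace_code_setting
begin

abbreviation "L \<equiv> defining_set \<alpha> e"
abbreviation "W a \<equiv> lee_weight L (ev q m L a)"

lemma defining_set_filter:
  "{x \<in> L. Q (base_part x) (u_part x)} = (\<lambda>(t, t'). Dual t t') ` (SIGMA t:H. {t'. Q t t'})"
  by (force simp: defining_set_def image_iff)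

lemma card_defining_set_filter:
  "card {x \<in> L. Q (base_part x) (u_part x)} = (\<Sum>t\<in>H. card {t'. Q t t'})"
proof -
  have "inj_on (\<lambda>(t, t'). Dual t t') (SIGMA t:H. {t'. Q t t'})" by (auto simp: inj_on_def)
  thus ?thesis by (simp add: defining_set_filter card_image)
qed

lemma finite_defining_set: "finite L"
  using defining_set_filter[of "\<lambda>_ _. True"] by simp

lemma card_defining_set: "real (card L) = (real r ^ 2 - real r) / real e"
  using card_defining_set_filter[of "\<lambda>_ _. True"] e_pos
  by (simp add: CARD_eq card_cyclic_subgroup field_simps power2_eq_square)

text \<open>The product of \<open>a + u b\<close> and \<open>t + u t'\<close> is
  \<open>a t + u (a t' + b t)\<close>. Adding the two parts for the second Gray block replaces
  \<open>b\<close> by \<open>a + b\<close>.\<close>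

lemma lee_weight_ev:
  "W (Dual a b) = (\<Sum>t\<in>H. card {t'. T (a * t' + b * t) \<noteq> 0})
     + (\<Sum>t\<in>H. card {t'. T (a * t' + (a + b) * t) \<noteq> 0})"
proof -
  have "base_part (ev q m L (Dual a b) x) = T (a * base_part x)"
    "u_part (ev q m L (Dual a b) x) = T (a * u_part x + b * base_part x)" if "x \<in> L" for x
    using that by (simp_all add: ev_def dual_trace_def times_dual_def)
  moreover have "T (a * t) + T (a * t' + b * t) = T (a * t' + (a + b) * t)" for t t'
    by (simp only: trace_add[symmetric] distrib_right add_ac)
  ultimately have "W (Dual a b) = card {x \<in> L. T (a * u_part x + b * base_part x) \<noteq> 0} +
      card {x \<in> L. T (a * u_part x + (a + b) * base_part x) \<noteq> 0}"
    unfolding lee_weight_eq[OF finite_defining_set]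
    by (intro arg_cong2[where f = "(+)"] arg_cong[where f = card]) auto
  thus ?thesis
    using card_defining_set_filter[of "\<lambda>t t'. T (a * t' + b * t) \<noteq> 0"]
      card_defining_set_filter[of "\<lambda>t t'. T (a * t' + (a + b) * t) \<noteq> 0"] by simp
qed

lemma real_lee_weight_unit:
  assumes "a \<noteq> 0"
  shows "real (W (Dual a b)) = 2 * ((real q - 1) / (real e * real q)) * (real r ^ 2 - real r)"
proof -
  have "q ^ (m - 1) \<le> r" using q_gt_1 by (intro power_increasing) auto
  hence "real (r - q ^ (m - 1)) = real r - real r / real q"
    by (simp only: of_nat_diff card_trace_fibre_real)
  \<comment> \<open>For each \<open>t\<close> both blocks are affine in \<open>t'\<close> with
    nonzero slope \<open>a\<close>, so the shifts \<open>b * t\<close> and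
    \<open>(a + b) * t\<close> do not influence the count.\<close>
  moreover have "W (Dual a b) = card H * (r - q ^ (m - 1)) + card H * (r - q ^ (m - 1))"
    by (simp only: lee_weight_ev card_trace_affine_neq_0[OF assms] sum_constant of_nat_id)
  ultimately have "real (W (Dual a b)) = 2 * ((real r - 1) / real e * (real r - real r / real q))"
    by (simp only: of_nat_add of_nat_mult card_cyclic_subgroup mult_2)
  moreover have "2 * ((R - 1) / E * (R - R / Q)) = 2 * ((Q - 1) / (E * Q)) * (R ^ 2 - R)"
    if "E \<noteq> 0" "Q \<noteq> 0" for R Q E :: real
    using that by (simp add: field_simps power2_eq_square)
  ultimately show ?thesis using e_pos q_gt_1 by (simp only: of_nat_eq_0_iff)
qed

text \<open>For \<open>a = 0\<close> the two Gray blocks coincide and do not depend on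
  \<open>t'\<close>, whence the factors 2 and \<open>r\<close>.\<close>

lemma real_lee_weight_nonunit: "real e * real (W (Dual 0 b)) = 2 * real r * (real r - N b)"
proof -
  have "W (Dual 0 b) = 2 * (\<Sum>t\<in>H. card {t'::'a. T (b * t) \<noteq> 0})"
    by (simp only: lee_weight_ev mult_zero_left add_0_left mult_2)
  also have "(\<Sum>t\<in>H. card {t'::'a. T (b * t) \<noteq> 0}) = (\<Sum>t\<in>H. if T (b * t) \<noteq> 0 then r else 0)"
    by (rule sum.cong) (auto simp: CARD_eq)
  also have "\<dots> = r * card {t \<in> H. T (b * t) \<noteq> 0}"
    by (simp add: sum.If_cases Int_def)
  finally have "real e * real (W (Dual 0 b)) = 2 * real r * (real e * real (card {t \<in> H. T (b * t) \<noteq> 0}))"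
    by simp
  thus ?thesis by (simp only: card_trace_cyclic_subgroup)
qed

lemma real_powr_three_halves: "real r powr (3 / 2) = real r * sqrt (real r)"
proof -
  have "real r powr (3 / 2) = real r powr (1 + 1 / 2)" by simp
  also have "\<dots> = real r powr 1 * real r powr (1 / 2)" by (rule powr_add)
  finally show ?thesis using real_r_gt_1 by (simp only: powr_one powr_half_sqrt of_nat_0_le_iff)
qed

text \<open>The parameter \<epsilon> is taken as 1 and -1. More zeros mean a smaller weight, so its
  sign flips between \<open>N\<close> and the weight.\<close>

lemma real_lee_weight_of_N:
  assumes "N b = real r / real q + \<epsilon> * (sqrt (real r) * (real q - 1) / real q)"
  shows "real (W (Dual 0 b)) =
    2 * ((real q - 1) / (real e * real q)) * (real r ^ 2 - \<epsilon> * real r powr (3 / 2))"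
proof -
  have "x = 2 * ((Q - 1) / (E * Q)) * (R ^ 2 - \<epsilon> * (R * S))"
    if "E * x = 2 * R * (R - (R / Q + \<epsilon> * (S * (Q - 1) / Q)))" "E \<noteq> 0" "Q \<noteq> 0" for R Q E S x :: real
  proof -
    have "x = 2 * R * (R - (R / Q + \<epsilon> * (S * (Q - 1) / Q))) / E"
      using that(1,2) by (simp add: nonzero_eq_divide_eq mult.commute)
    thus ?thesis using that(2,3) by (simp add: field_simps power2_eq_square)
  qed
  note solve = this
  show ?thesis
    unfolding real_powr_three_halves
    by (rule solve[OF real_lee_weight_nonunit[of b, unfolded assms]]) (use e_pos q_gt_1 in auto)
qed

lemma lee_weight_0: "W 0 = 0"
  by (simp add: zero_dual_def lee_weight_ev)

lemma ev_0: "ev q m L 0 = (\<lambda>i\<in>L. 0)"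
  by (simp add: ev_def dual_trace_def zero_dual_def times_dual_def fun_eq_iff restrict_def)

lemma ev_diff:
  assumes "ev q m L a = ev q m L b" shows "ev q m L (a - b) = (\<lambda>i\<in>L. 0)"
proof -
  have "dual_trace q m ((a - b) * x) = 0" if "x \<in> L" for x
  proof -
    have "dual_trace q m (a * x) = dual_trace q m (b * x)"
      using fun_cong[OF assms, of x] that by (simp add: ev_def)
    moreover have "dual_trace q m (y - z) = dual_trace q m y - dual_trace q m z" for y z :: "'a dual"
      by (simp add: dual_trace_def minus_dual_def trace_diff)
    ultimately show ?thesis by (simp add: left_diff_distrib)
  qed
  thus ?thesis by (auto simp: ev_def fun_eq_iff restrict_def)
qed

lemma ev_in_words: "ev q m L a \<in> L \<rightarrow>\<^sub>E dual_over F"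
  by (auto simp: ev_def dual_trace_def dual_over_def trace_in_F)

text \<open>The weights are defined as those of concrete codewords, so they are natural numbers by
  construction; \<open>b1\<close> and \<open>b3\<close> witness that both extreme values occur. The
  strict order gives three distinct values, and \<open>0 < w1\<close> gives injectivity of
  \<open>ev\<close>.\<close>

lemma lee_weights:
  obtains P b1 b3 w1 w2 w3 where
    "b1 \<in> P" "b3 \<notin> P" "b3 \<noteq> 0"
    "real (card P) = (real r - 1) / 2" "real (card (UNIV - {0} - P)) = (real r - 1) / 2"
    "0 \<notin> P" "0 < w1" "w1 < w2" "w2 < w3"
    "real w1 = 2 * ((real q - 1) / (real e * real q)) * (real r ^ 2 - real r powr (3 / 2))"
    "real w2 = 2 * ((real q - 1) / (real e * real q)) * (real r ^ 2 - real r)"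
    "real w3 = 2 * ((real q - 1) / (real e * real q)) * (real r ^ 2 + real r powr (3 / 2))"
    "\<And>a b. W (Dual a b) = (if a \<noteq> 0 then w2 else if b \<in> P then w1 else if b \<noteq> 0 then w3 else 0)"
proof -
  let ?c = "2 * ((real q - 1) / (real e * real q))"
  obtain P where P: "P \<subseteq> UNIV - {0}" "real (card P) = (real r - 1) / 2"
    "real (card (UNIV - {0} - P)) = (real r - 1) / 2"
    and N1: "\<And>b. b \<in> P \<Longrightarrow> N b = real r / real q + sqrt (real r) * (real q - 1) / real q"
    and N3: "\<And>b. b \<notin> P \<Longrightarrow> b \<noteq> 0 \<Longrightarrow> N b = real r / real q - sqrt (real r) * (real q - 1) / real q"
    using N_distribution by blast
  have "A \<noteq> {}" if "real (card A) = (real r - 1) / 2" for A :: "'a set"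
  proof
    assume "A = {}"
    hence "(real r - 1) / 2 = 0" using that by (simp only: card.empty of_nat_0)
    thus False using real_r_gt_1 by simp
  qed
  from this[OF P(2)] this[OF P(3)] have "P \<noteq> {}" "UNIV - {0} - P \<noteq> {}" .
  then obtain b1 b3 where b: "b1 \<in> P" "b3 \<notin> P" "b3 \<noteq> 0" by blast
  have W1: "real (W (Dual 0 b)) = ?c * (real r ^ 2 - real r powr (3 / 2))" if "b \<in> P" for b
    using real_lee_weight_of_N[of b 1] N1[OF that] by simp
  have W3: "real (W (Dual 0 b)) = ?c * (real r ^ 2 + real r powr (3 / 2))" if "b \<notin> P" "b \<noteq> 0" for b
    using real_lee_weight_of_N[of b "-1"] N3[OF that] by simp
  let ?w1 = "W (Dual 0 b1)" and ?w2 = "W (Dual 1 0)" and ?w3 = "W (Dual 0 b3)"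
  note w1 = W1[OF b(1)] and w2 = real_lee_weight_unit[OF one_neq_zero, of 0] and w3 = W3[OF b(2,3)]
  have c: "?c > 0" using q_gt_1 e_pos by simp
  \<comment> \<open>Multiplying \<open>1 < sqrt r < r\<close> by \<open>r\<close> puts
    \<open>r powr (3 / 2)\<close> strictly between \<open>r\<close> and \<open>r ^ 2\<close>, which
    orders the weights.\<close>
  have s: "sqrt (real r) > 1" "real r = sqrt (real r) * sqrt (real r)" using real_r_gt_1 by auto
  have "sqrt (real r) * 1 < sqrt (real r) * sqrt (real r)"
    by (rule mult_strict_left_mono[OF s(1)]) (use s(1) in linarith)
  hence "sqrt (real r) < real r" using s(2) by linarith
  have R: "0 < real r" using real_r_gt_1 by linarith
  have lt: "real r powr (3 / 2) < real r ^ 2" "real r < real r powr (3 / 2)"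
    using mult_strict_left_mono[OF \<open>sqrt (real r) < real r\<close> R] mult_strict_left_mono[OF s(1) R]
    by (simp_all only: real_powr_three_halves power2_eq_square mult_1_right)
  show ?thesis
  proof (rule that[of b1 P b3 ?w1 ?w2 ?w3])
    have "0 < real ?w1" unfolding w1 using c lt by (intro mult_pos_pos) linarith+
    thus "0 < ?w1" by (simp only: of_nat_0_less_iff)
    have "real ?w1 < real ?w2" unfolding w1 w2 using c lt by (intro mult_strict_left_mono) linarith+
    thus "?w1 < ?w2" by (simp only: of_nat_less_iff)
    have "real ?w2 < real ?w3" unfolding w2 w3 using c lt R by (intro mult_strict_left_mono) linarith+
    thus "?w2 < ?w3" by (simp only: of_nat_less_iff)
    show "W (Dual a b) = (if a \<noteq> 0 then ?w2 else if b \<in> P then ?w1 else if b \<noteq> 0 then ?w3 else 0)" for a b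
    proof (cases "a = 0")
      case False
      have "real (W (Dual a b)) = real ?w2" by (simp only: real_lee_weight_unit[OF False] w2)
      thus ?thesis using False by (simp only: of_nat_eq_iff) simp
    next
      case True
      consider "b \<in> P" | "b \<notin> P" "b \<noteq> 0" | "b \<notin> P" "b = 0" by blast
      thus ?thesis
      proof cases
        case 1
        hence "real (W (Dual a b)) = real ?w1" by (simp only: True W1 w1)
        thus ?thesis using 1 True by (simp only: of_nat_eq_iff) simp
      next
        case 2
        hence "real (W (Dual a b)) = real ?w3" using True W3[OF 2] w3 by (simp only:)
        thus ?thesis using 2 True by (simp only: of_nat_eq_iff) simp
      next
        case 3
        thus ?thesis using lee_weight_0 True by (simp add: zero_dual_def)
      qed
    qed
  qed (use P w1 w2 w3 b in auto)
qed

text \<open>By additivity a collision gives a zero codeword for \<open>a - b\<close>; nonzero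
  arguments have positive weight.\<close>

lemma inj_ev: "inj (ev q m L)"
proof (rule injI)
  fix a b assume "ev q m L a = ev q m L b"
  hence "ev q m L (a - b) = ev q m L 0" by (simp only: ev_diff ev_0)
  hence "W (a - b) = 0" using lee_weight_0 by (simp only:)
  moreover have "x = 0" if "W x = 0" for x :: "'a dual"
  proof -
    obtain P :: "'a set" and w1 w2 w3 where "0 < w1" "w1 < w2" "w2 < w3" and
      W: "\<And>a b. W (Dual a b) = (if a \<noteq> 0 then w2 else if b \<in> P then w1 else if b \<noteq> 0 then w3 else 0)"
      by (rule lee_weights) blast
    thus ?thesis using that W[of "base_part x" "u_part x"]
      by (cases x) (auto simp: zero_dual_def split: if_splits)
  qed
  ultimately have "a - b = 0" by blast
  thus "a = b" by simp
qed

section \<open>Size and weight enumerator of the code\<close>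

lemma UNIV_dual: "(UNIV :: 'a dual set) = (\<lambda>(a, b). Dual a b) ` (UNIV \<times> UNIV)"
  by (auto simp: image_iff) (metis dual.collapse)

lemma inj_Dual: "inj_on (\<lambda>(a, b). Dual a b) A"
  by (auto simp: inj_on_def)

lemma sum_UNIV_dual: "(\<Sum>x\<in>UNIV. f x) = (\<Sum>a::'a\<in>UNIV. \<Sum>b\<in>UNIV. f (Dual a b))"
  unfolding UNIV_dual sum.reindex[OF inj_Dual] sum.cartesian_product by (simp add: split_def)

lemma card_trace_code: "card (trace_code q m e \<alpha>) = r ^ 2"
proof -
  have "card (trace_code q m e \<alpha>) = card (UNIV :: 'a dual set)"
    unfolding trace_code_def by (rule card_image[OF inj_ev])
  also have "\<dots> = card ((UNIV :: 'a set) \<times> (UNIV :: 'a set))"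
    unfolding UNIV_dual by (rule card_image[OF inj_Dual])
  finally show ?thesis by (simp add: card_cartesian_product CARD_eq power2_eq_square)
qed

lemma trace_code_weights:
  obtains w1 w2 w3 where
    "real w1 = 2 * ((real q - 1) / (real e * real q)) * (real r ^ 2 - real r powr (3 / 2))"
    "real w2 = 2 * ((real q - 1) / (real e * real q)) * (real r ^ 2 - real r)"
    "real w3 = 2 * ((real q - 1) / (real e * real q)) * (real r ^ 2 + real r powr (3 / 2))"
    "lee_t_weight_code L 3 (trace_code q m e \<alpha>)"
    "lee_weight_enumerator L (trace_code q m e \<alpha>) =
      1 + monom ((real r - 1) / 2) w1 + monom (real r ^ 2 - real r) w2 + monom ((real r - 1) / 2) w3"
proof -
  obtain P b1 b3 w1 w2 w3 where b: "b1 \<in> P" "b3 \<notin> P" "b3 \<noteq> 0"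
    and P: "real (card P) = (real r - 1) / 2"
      "real (card (UNIV - {0} - P)) = (real r - 1) / 2" "0 \<notin> P"
    and less: "0 < w1" "w1 < w2" "w2 < w3"
    and w: "real w1 = 2 * ((real q - 1) / (real e * real q)) * (real r ^ 2 - real r powr (3 / 2))"
    "real w2 = 2 * ((real q - 1) / (real e * real q)) * (real r ^ 2 - real r)"
    "real w3 = 2 * ((real q - 1) / (real e * real q)) * (real r ^ 2 + real r powr (3 / 2))"
    and W: "\<And>a b. W (Dual a b) = (if a \<noteq> 0 then w2 else if b \<in> P then w1 else if b \<noteq> 0 then w3 else 0)"
    by (rule lee_weights) blast
  have "lee_weight L ` (trace_code q m e \<alpha> - {\<lambda>i\<in>L. 0}) = W ` (UNIV - {0})"
  proof -
    have "trace_code q m e \<alpha> - {\<lambda>i\<in>L. 0} = ev q m L ` (UNIV - {0})"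
      using image_set_diff[OF inj_ev, of UNIV "{0}"] by (simp add: trace_code_def ev_0)
    thus ?thesis by (simp add: image_image)
  qed
  also have "\<dots> = {w1, w2, w3}"
  proof (intro equalityI subsetI)
    fix v assume "v \<in> W ` (UNIV - {0})"
    then obtain x where "x \<noteq> 0" "v = W x" by auto
    thus "v \<in> {w1, w2, w3}" by (cases x) (auto simp: W zero_dual_def)
  next
    have "Dual 0 b1 \<noteq> 0" "Dual 1 0 \<noteq> (0 :: 'a dual)" "Dual 0 b3 \<noteq> 0"
      using b P(3) by (auto simp: zero_dual_def)
    moreover have "W (Dual 0 b1) = w1" "W (Dual 1 0) = w2" "W (Dual 0 b3) = w3"
      using b by (simp_all add: W)
    moreover fix v assume "v \<in> {w1, w2, w3}"
    ultimately show "v \<in> W ` (UNIV - {0})" by (auto simp: image_iff)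
  qed
  finally have "lee_t_weight_code L 3 (trace_code q m e \<alpha>)"
    using less by (simp add: lee_t_weight_code_def)
  moreover have "lee_weight_enumerator L (trace_code q m e \<alpha>) =
      1 + monom ((real r - 1) / 2) w1 + monom (real r ^ 2 - real r) w2 + monom ((real r - 1) / 2) w3"
  proof -
    let ?g = "\<lambda>a b. monom 1 (W (Dual a b)) :: real poly"
    \<comment> \<open>Injectivity of \<open>ev\<close> turns the sum over codewords into a sum over
      all pairs \<open>(a, b)\<close>, split below into \<open>a\<close> nonzero, the origin,
      \<open>P\<close> and its complement.\<close>
    have "lee_weight_enumerator L (trace_code q m e \<alpha>) = (\<Sum>x\<in>UNIV. monom 1 (W x))"
      by (simp add: lee_weight_enumerator_def trace_code_def sum.reindex[OF inj_ev])
    also have "\<dots> = (\<Sum>a\<in>UNIV. \<Sum>b\<in>UNIV. ?g a b)" by (rule sum_UNIV_dual)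
    also have "\<dots> = (\<Sum>b\<in>UNIV. ?g 0 b) + (\<Sum>a\<in>UNIV - {0}. \<Sum>b\<in>UNIV. ?g a b)"
      by (rule sum.remove) auto
    also have "(\<Sum>b\<in>UNIV. ?g 0 b) = ?g 0 0 + (\<Sum>b\<in>UNIV - {0}. ?g 0 b)"
      by (rule sum.remove) auto
    also have "(\<Sum>b\<in>UNIV - {0}. ?g 0 b) = (\<Sum>b\<in>UNIV - {0} - P. ?g 0 b) + (\<Sum>b\<in>P. ?g 0 b)"
      using P(3) by (intro sum.subset_diff) auto
    also have "(\<Sum>b\<in>P. ?g 0 b) = (\<Sum>b\<in>P. monom 1 w1)" by (rule sum.cong) (auto simp: W)
    also have "(\<Sum>b\<in>UNIV - {0} - P. ?g 0 b) = (\<Sum>b\<in>UNIV - {0} - P. monom 1 w3)"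
      by (rule sum.cong) (auto simp: W)
    also have "?g 0 0 = 1" using P(3) by (simp add: W)
    also have "(\<Sum>a\<in>UNIV - {0}. \<Sum>b\<in>UNIV. ?g a b) =
        (\<Sum>x\<in>(UNIV - {0 :: 'a}) \<times> (UNIV :: 'a set). monom 1 w2)"
      unfolding sum.cartesian_product
      by (rule sum.cong) (simp_all add: W split_def mem_Times_iff)
    finally have "lee_weight_enumerator L (trace_code q m e \<alpha>) =
      1 + (monom ((real r - 1) / 2) w3 + monom ((real r - 1) / 2) w1)
        + monom (real (card ((UNIV - {0 :: 'a}) \<times> (UNIV :: 'a set)))) w2"
      by (simp only: sum_monom_const P)
    moreover have "real (card ((UNIV - {0 :: 'a}) \<times> (UNIV :: 'a set))) = real r ^ 2 - real r"
      using of_nat_diff[of 1 r, where 'a = real] r_gt_1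
      by (simp add: card_cartesian_product CARD_eq power2_eq_square left_diff_distrib)
    ultimately show ?thesis by (simp only: add_ac)
  qed
  ultimately show ?thesis using w by (intro that)
qed

end

theorem theorem3p7:
  fixes p s q m r e :: nat and F :: "'a::{field,finite} set" and \<alpha> :: 'a
  assumes "prime p" and "s \<ge> 1" and "q = p ^ s"
    and "m \<ge> 1" and "r = q ^ m"
    and "CARD('a) = r"
    and "is_subfield F" and "card F = q"
    and "is_generator \<alpha>"
    and "e > 0" and "e dvd q - 1"
    and "gcd e m = 2"
  shows "trace_code q m e \<alpha> \<subseteq> defining_set \<alpha> e \<rightarrow>\<^sub>E dual_over F \<and>
    real (card (defining_set \<alpha> e)) = (real r ^ 2 - real r) / real e \<and>
    card (trace_code q m e \<alpha>) = r ^ 2 \<and>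
    lee_t_weight_code (defining_set \<alpha> e) 3 (trace_code q m e \<alpha>) \<and>
    (\<exists>w1 w2 w3 :: nat.
      real w1 = 2 * ((real q - 1) / (real e * real q)) * (real r ^ 2 - real r powr (3 / 2)) \<and>
      real w2 = 2 * ((real q - 1) / (real e * real q)) * (real r ^ 2 - real r) \<and>
      real w3 = 2 * ((real q - 1) / (real e * real q)) * (real r ^ 2 + real r powr (3 / 2)) \<and>
      lee_weight_enumerator (defining_set \<alpha> e) (trace_code q m e \<alpha>) =
        1 + monom ((real r - 1) / 2) w1 + monom (real r ^ 2 - real r) w2
          + monom ((real r - 1) / 2) w3)"
proof -
  interpret trace_code_setting p s q m F \<alpha> e
    by standard (use assms in auto)
  have "trace_code q m e \<alpha> \<subseteq> defining_set \<alpha> e \<rightarrow>\<^sub>E dual_over F"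
    unfolding trace_code_def using ev_in_words by blast
  moreover obtain w1 w2 w3 where
    "real w1 = 2 * ((real q - 1) / (real e * real q)) * (real (q ^ m) ^ 2 - real (q ^ m) powr (3 / 2))"
    "real w2 = 2 * ((real q - 1) / (real e * real q)) * (real (q ^ m) ^ 2 - real (q ^ m))"
    "real w3 = 2 * ((real q - 1) / (real e * real q)) * (real (q ^ m) ^ 2 + real (q ^ m) powr (3 / 2))"
    "lee_t_weight_code (defining_set \<alpha> e) 3 (trace_code q m e \<alpha>)"
    "lee_weight_enumerator (defining_set \<alpha> e) (trace_code q m e \<alpha>) =
      1 + monom ((real (q ^ m) - 1) / 2) w1 + monom (real (q ^ m) ^ 2 - real (q ^ m)) w2
        + monom ((real (q ^ m) - 1) / 2) w3"
    by (rule trace_code_weights)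
  ultimately show ?thesis
    unfolding \<open>r = q ^ m\<close> using card_defining_set card_trace_code by blast
qed

end
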